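(* The isomorphisms $\psi_n$ ($\Delta\mapsto\mathcal{W}(\Delta)$, $|\Delta|=n$, $n\ge1$) give rise to an isomorphism of algebras $\psi:A_\infty\to\mathcal{W}_\infty$; that is, the linear map $\psi$ with $\psi(G_\infty(\Delta))=\mathcal{W}(\Delta)$ for every Young diagram $\Delta$ is an isomorphism from the algebra $A_\infty$ onto the algebra $\mathcal{W}_\infty$ of differential operators under composition.
   Context: Vector spaces are over $\mathbb{C}$; algebras and subalgebras are not required to have a unit; Young diagrams have degree $\ge1$. The algebra $A_\infty$. A finite permutation of $\mathbb{N}=\{1,2,\dots\}$ is a pair $(d,w)$, where $d\subset\mathbb{N}$ is a finite nonempty set and $w$ is a permutation of $d$ (extended by the identity outside $d$). The product is $(d_1,w_1)(d_2,w_2)=(d_1\cup d_2,\,w_1w_2)$. The cyclic type of $(d,w)$ is the Young diagram of degree $|d|$ whose row lengths are the lengths of all cycles of $w$ on $d$ (fixed points in $d$ included). $G_\infty(\Delta)$ is the formal sum of all finite permutations of cyclic type $\Delta$. $A_\infty$ is the vector space spanned by all $G_\infty(\Delta)$, with multiplication induced by multiplication of finite permutations (each product $G_\infty(\Delta_1)G_\infty(\Delta_2)$ is a finite linear combination of $G_\infty(\Delta)$'s). The algebra $\mathcal{W}_\infty$. Let $\{X_{ij}\}_{i,j\in\mathbb{N}}$ be commuting variables. For $n\ge1$ put $$:D_{a_1b_1}\cdots D_{a_nb_n}:\;=\sum_{e_1,\dots,e_n\in\mathbb{N}}X_{a_1e_1}\cdots X_{a_ne_n}\frac{\partial}{\partial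 X_{b_1e_1}}\cdots\frac{\partial}{\partial X_{b_ne_n}},$$ acting on polynomials in the $X_{ij}$. $U_n$ is the space of finite or countable formal complex linear combinations of such operators of degree $n$, where for each fixed $(b_1,\dots,b_n)$ only finitely many $(a_1,\dots,a_n)$ occur with nonzero coefficient. $U_\infty=\bigoplus_{n\ge1}U_n$ is an algebra under composition. For a Young diagram $\Delta$ of degree $n$ with exactly $m_k$ rows of length $k$ ($k\ge1$), put $\kappa(\Delta)=\big(\prod_k m_k!\,k^{m_k}\big)^{-1}$ and $$\mathcal{W}(\Delta)=\kappa(\Delta)\,:\prod_k(\operatorname{tr}D^k)^{m_k}:\;=\kappa(\Delta)\sum_{a_1,\dots,a_n\in\mathbb{N}}:D_{a_1a_{g(1)}}\cdots D_{a_na_{g(n)}}:\;\in U_n,$$ where $g\in S_n$ is any permutation of cyclic type $\Delta$. $\mathcal{W}_\infty\subset U_\infty$ is the subalgebra generated by all the operators $\mathcal{W}(\Delta)$. *)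

theory Defs
  imports
    Complex_Main
    "HOL-Library.Multiset"
    "HOL-Library.Function_Algebras"
    "HOL-Library.Poly_Mapping"
    "HOL-Combinatorics.Permutations"
    "HOL-Combinatorics.Orbits"
begin

text \<open>
  Throughout, the type \<^typ>\<open>nat\<close> (counting from \<open>0\<close>) plays the role of the countable index
  set \<open>{1, 2, \<dots>}\<close>, and \<open>S\<^sub>n\<close> is the set of permutations of \<^term>\<open>{..<n}\<close>.
\<close>


section \<open>Young diagrams and cyclic types\<close>

text \<open>A Young diagram of degree at least 1 is the multiset of its row lengths.\<close>

definition young_diagram :: "nat multiset \<Rightarrow> bool" where
  "young_diagram \<Delta> \<longleftrightarrow> \<Delta> \<noteq> {#} \<and> 0 \<notin># \<Delta>"

abbreviation degree :: "nat multiset \<Rightarrow> nat" where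
  "degree \<Delta> \<equiv> sum_mset \<Delta>"

type_synonym fperm = "nat set \<times> (nat \<Rightarrow> nat)"

definition finite_permutations :: "fperm set" where
  "finite_permutations = {(d, w). finite d \<and> d \<noteq> {} \<and> w permutes d}"

text \<open>
  For a permutation \<open>w\<close> of a finite set \<open>d\<close>, the orbits \<^term>\<open>orbit w x\<close> with \<open>x \<in> d\<close> are the
  supports of the cycles of \<open>w\<close> on \<open>d\<close>; a fixed point gives an orbit of size 1.
\<close>

definition cyclic_type :: "fperm \<Rightarrow> nat multiset" where
  "cyclic_type = (\<lambda>(d, w). image_mset card (mset_set (orbit w ` d)))"

definition fperm_mult :: "fperm \<Rightarrow> fperm \<Rightarrow> fperm" where
  "fperm_mult = (\<lambda>(d1, w1) (d2, w2). (d1 \<union> d2, w1 \<circ> w2))"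


section \<open>Linear maps and isomorphisms of algebras\<close>

definition linear_map_on ::
  "(complex \<Rightarrow> 'a \<Rightarrow> 'a::ab_group_add) \<Rightarrow> (complex \<Rightarrow> 'b \<Rightarrow> 'b::ab_group_add)
    \<Rightarrow> 'a set \<Rightarrow> ('a \<Rightarrow> 'b) \<Rightarrow> bool" where
  "linear_map_on scaleA scaleB A \<psi> \<longleftrightarrow>
     (\<forall>x\<in>A. \<forall>y\<in>A. \<psi> (x + y) = \<psi> x + \<psi> y) \<and>
     (\<forall>c. \<forall>x\<in>A. \<psi> (scaleA c x) = scaleB c (\<psi> x))"

text \<open>
  No unit is required.  The second and third conjuncts make sure that \<open>A\<close> and \<open>B\<close> really are
  algebras under the given multiplications.
\<close>

definition algebra_isomorphism ::
  "(complex \<Rightarrow> 'a \<Rightarrow> 'a::ab_group_add) \<Rightarrow> ('a \<Rightarrow> 'a \<Rightarrow> 'a) \<Rightarrow> 'a set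
    \<Rightarrow> (complex \<Rightarrow> 'b \<Rightarrow> 'b::ab_group_add) \<Rightarrow> ('b \<Rightarrow> 'b \<Rightarrow> 'b) \<Rightarrow> 'b set
    \<Rightarrow> ('a \<Rightarrow> 'b) \<Rightarrow> bool" where
  "algebra_isomorphism scaleA multA A scaleB multB B \<psi> \<longleftrightarrow>
     linear_map_on scaleA scaleB A \<psi> \<and>
     (\<forall>x\<in>A. \<forall>y\<in>A. multA x y \<in> A) \<and>
     (\<forall>x\<in>B. \<forall>y\<in>B. multB x y \<in> B) \<and>
     (\<forall>x\<in>A. \<forall>y\<in>A. \<psi> (multA x y) = multB (\<psi> x) (\<psi> y)) \<and>
     bij_betw \<psi> A B"


section \<open>The algebra of formal sums of finite permutations\<close>

text \<open>
  A formal sum of finite permutations is represented by its coefficient function.  Addition is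
  pointwise (\<^theory>\<open>HOL-Library.Function_Algebras\<close>).
\<close>

type_synonym formal_sum = "fperm \<Rightarrow> complex"

definition fs_scale :: "complex \<Rightarrow> formal_sum \<Rightarrow> formal_sum" where
  "fs_scale c F = (\<lambda>p. c * F p)"

interpretation fs: vector_space fs_scale
  by unfold_locales (auto simp: fs_scale_def algebra_simps fun_eq_iff)

text \<open>
  The product induced by \<^const>\<open>fperm_mult\<close>.  The sum is finite, since \<open>(d, w)\<close> can only be a
  product of finite permutations on subsets of \<open>d\<close>.
\<close>

definition fs_mult :: "formal_sum \<Rightarrow> formal_sum \<Rightarrow> formal_sum" where
  "fs_mult F G = (\<lambda>p. \<Sum>(q, r) \<in> {(q, r). q \<in> finite_permutations \<and> r \<in> finite_permutations \<and>
                                     fperm_mult q r = p}. F q * G r)"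

definition G_inf :: "nat multiset \<Rightarrow> formal_sum" where
  "G_inf \<Delta> = (\<lambda>p. if p \<in> finite_permutations \<and> cyclic_type p = \<Delta> then 1 else 0)"

definition A_inf :: "formal_sum set" where
  "A_inf = fs.span {G_inf \<Delta> | \<Delta>. young_diagram \<Delta>}"


section \<open>Differential operators on polynomials\<close>

text \<open>
  Polynomials in the commuting variables \<open>X\<^sub>i\<^sub>j\<close>: a monomial is its finitely supported
  exponent function, a polynomial its finitely supported coefficient function.
\<close>

type_synonym pol = "(nat \<times> nat \<Rightarrow>\<^sub>0 nat) \<Rightarrow>\<^sub>0 complex"

type_synonym operator = "pol \<Rightarrow> pol"

definition X :: "nat \<times> nat \<Rightarrow> pol" where
  "X v = Poly_Mapping.single (Poly_Mapping.single v 1) 1"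

definition pol_const :: "complex \<Rightarrow> pol" where
  "pol_const c = Poly_Mapping.single 0 c"

text \<open>
  Subtraction of exponents is truncated; monomials not involving \<open>v\<close> get coefficient 0.
\<close>

definition partial :: "nat \<times> nat \<Rightarrow> operator" where
  "partial v f = (\<Sum>m \<in> Poly_Mapping.keys f.
     Poly_Mapping.single (m - Poly_Mapping.single v 1)
       (of_nat (Poly_Mapping.lookup m v) * Poly_Mapping.lookup f m))"

definition op_scale :: "complex \<Rightarrow> operator \<Rightarrow> operator" where
  "op_scale c T = (\<lambda>f. pol_const c * T f)"

interpretation op: vector_space op_scale
  by unfold_locales
    (auto simp: op_scale_def pol_const_def algebra_simps fun_eq_iff single_add mult_single
      simp flip: mult.assoc)

text \<open>
  \<open>normal_D [a\<^sub>1, \<dots>, a\<^sub>n] [b\<^sub>1, \<dots>, b\<^sub>n]\<close> is the operator \<open>:D\<^bsub>a\<^sub>1b\<^sub>1\<^esub> \<cdots> D\<^bsub>a\<^sub>nb\<^sub>n\<^esub>:\<close>; the two lists are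
  meant to have the same length.  For every polynomial only finitely many summands do not
  vanish, so \<^const>\<open>Sum_any\<close> is the intended sum, here and in the following definitions.
\<close>

definition normal_D :: "nat list \<Rightarrow> nat list \<Rightarrow> operator" where
  "normal_D as bs f = Sum_any (\<lambda>es.
     prod_list (map X (zip as es)) * foldr partial (zip bs es) f when length es = length as)"

text \<open>
  A formal linear combination of operators of degree \<open>n\<close> has coefficients \<open>c as bs\<close>; it is
  identified with the operator it defines on polynomials.  This operator is well-defined if for
  each \<open>bs\<close> only finitely many \<open>c as bs\<close> do not vanish.
\<close>

definition D_series :: "nat \<Rightarrow> (nat list \<Rightarrow> nat list \<Rightarrow> complex) \<Rightarrow> operator" where
  "D_series n c f = Sum_any (\<lambda>(as, bs).
     op_scale (c as bs) (normal_D as bs) f when length as = n \<and> length bs = n)"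

definition U :: "nat \<Rightarrow> operator set" where
  "U n = {D_series n c | c.
            \<forall>bs. length bs = n \<longrightarrow> finite {as. length as = n \<and> c as bs \<noteq> 0}}"

definition U_inf :: "operator set" where
  "U_inf = op.span (\<Union>n\<in>{1..}. U n)"


section \<open>The algebra generated by the operators attached to Young diagrams\<close>

definition kappa :: "nat multiset \<Rightarrow> complex" where
  "kappa \<Delta> = inverse (\<Prod>k\<in>set_mset \<Delta>. fact (count \<Delta> k) * of_nat k ^ count \<Delta> k)"

text \<open>The operator does not depend on the choice of the permutation \<open>g\<close> of cyclic type \<open>\<Delta>\<close>.\<close>

definition W :: "nat multiset \<Rightarrow> operator" where
  "W \<Delta> = (let n = degree \<Delta>;
              g = (SOME g. g permutes {..<n} \<and> cyclic_type ({..<n}, g) = \<Delta>)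
          in op_scale (kappa \<Delta>) (\<lambda>f. Sum_any (\<lambda>as.
               normal_D as (map (\<lambda>i. as ! g i) [0..<n]) f when length as = n)))"

definition subalgebra_of_U_inf :: "operator set \<Rightarrow> bool" where
  "subalgebra_of_U_inf B \<longleftrightarrow> B \<subseteq> U_inf \<and> op.subspace B \<and> (\<forall>S\<in>B. \<forall>T\<in>B. S \<circ> T \<in> B)"

definition W_inf :: "operator set" where
  "W_inf = subalgebra_of_U_inf hull {W \<Delta> | \<Delta>. young_diagram \<Delta>}"

end

theory Submission
  imports Defs
begin

text \<open>
  The operators \<open>W \<Delta>\<close> are best understood through their action on a product
  \<open>\<Prod>i\<in>I. X (x i, e i)\<close> of variables indexed by a finite set \<open>I\<close>.  Applying \<open>:D\<^bsub>a\<^sub>1b\<^sub>1\<^esub> \<cdots> D\<^bsub>a\<^sub>nb\<^sub>n\<^esub>:\<close>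
  means choosing \<open>n\<close> distinct factors, listed by \<open>js\<close>, whose row indices are \<open>b\<^sub>1, \<dots>, b\<^sub>n\<close>, and
  replacing these row indices by \<open>a\<^sub>1, \<dots>, a\<^sub>n\<close>.  In a product of traces \<open>b\<^sub>i = a\<^bsub>g(i)\<^esub>\<close>, so the new row
  indices are the old ones, permuted along \<open>g\<close> transported to the set of the chosen factors.
  Every permutation \<open>w\<close> of a subset \<open>d \<subseteq> I\<close> with the cyclic type \<open>\<Delta>\<close> of \<open>g\<close> arises in this way, from as
  many lists \<open>js\<close> as there are bijections conjugating \<open>g\<close> to \<open>w\<close>, and this number is exactly the
  inverse of \<open>\<kappa>(\<Delta>)\<close> (\<open>card_conjugators\<close>).  Hence \<open>W \<Delta>\<close> sends the product to
  \<open>\<Sum>\<^bsub>(d,w)\<^esub> \<Prod>i\<in>I. X (x (w\<inverse> i), e i)\<close>, the sum ranging over the finite permutations within \<open>I\<close> of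
  cyclic type \<open>\<Delta>\<close>: it acts as the formal sum \<open>G_inf \<Delta>\<close> does under the left action of finite
  permutations on row indices (\<open>represents_W\<close>).

  This suggests calling a linear operator \<open>T\<close> represented by a formal sum \<open>F\<close> if \<open>T\<close> acts on all such
  products by \<open>\<Sum>p. F p \<cdot> p\<close>, summed over the finite permutations \<open>p\<close> within \<open>I\<close>.  Representation is
  compatible with linear combinations and turns the product of formal sums into composition
  (\<open>represents_comp\<close>), because it comes from an action.  It determines \<open>T\<close>, since the products of
  variables span the polynomials, and it determines \<open>F\<close> (\<open>represents_unique_formal_sum\<close>): on the
  product of the \<open>X (i, i)\<close> with \<open>i \<in> d\<close> distinct permutations of \<open>d\<close> give distinct monomials,
  and induction on the size of \<open>d\<close> isolates the coefficient of \<open>(d, w)\<close> from those of \<open>(d', w)\<close>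
  with \<open>d' \<subset> d\<close>.  So \<open>\<psi>\<close>, which sends \<open>F\<close> to the operator that it represents, is an injective
  homomorphism.

  It remains to see that both sides are algebras.  The span \<open>A_inf\<close> consists of the class
  functions with bounded support; these are closed under multiplication because conjugation by a
  permutation of the natural numbers is an automorphism of the semigroup of finite permutations.  The
  image of \<open>\<psi>\<close> is then closed under composition; it is the span of the \<open>W \<Delta>\<close>, hence the
  algebra that they generate.
\<close>

section \<open>Cyclic types of permutations of finite sets\<close>

text \<open>
  The values of \<open>w\<close> outside \<open>d\<close> are left arbitrary, so that an orbit can be removed from \<open>d\<close>
  without changing \<open>w\<close>; the facts are transferred from the permutation that agrees with
  \<open>w\<close> on \<open>d\<close> and is the identity outside.
\<close>

lemma orbit_of_bij_betw:
  assumes "finite d" "bij_betw w d d" "x \<in> d"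
  shows "x \<in> orbit w x" "orbit w x \<subseteq> d" "bij_betw w (orbit w x) (orbit w x)"
proof -
  let ?v = "\<lambda>x. if x \<in> d then w x else x"
  have v: "?v permutes d"
  proof (rule bij_imp_permutes)
    show "bij_betw ?v d d"
      using assms(2) by (simp cong: bij_betw_cong)
  qed auto
  have eq: "orbit w x = orbit ?v x"
    by (rule orbit_cong0[OF assms(3)]) (use assms(2) in \<open>auto dest: bij_betwE\<close>)
  show 1: "x \<in> orbit w x"
    unfolding eq using v assms(1) by (intro permutation_self_in_orbit) (auto simp: permutation_permutes)
  show 2: "orbit w x \<subseteq> d"
    unfolding eq using v assms(3) by (rule permutes_orbit_subset)
  have "inj_on w (orbit w x)"
    using assms(2) 2 by (meson bij_betw_imp_inj_on inj_on_subset)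
  moreover have "w ` orbit w x \<subseteq> orbit w x"
    by (auto intro: orbit.step)
  ultimately show "bij_betw w (orbit w x) (orbit w x)"
    using finite_subset[OF 2 assms(1)] by (auto simp: bij_betw_def endo_inj_surj)
qed

lemma orbit_eq_of_mem:
  assumes "finite d" "bij_betw w d d" "x \<in> d" "y \<in> orbit w x"
  shows "orbit w y = orbit w x"
  using orbit_of_bij_betw(1)[OF assms(1-3)] assms(4)
  by (metis orbit_swap orbit_trans subsetI subset_antisym)

lemma bij_betw_minus_orbit:
  assumes "finite d" "bij_betw w d d" "x \<in> d"
  shows "bij_betw w (d - orbit w x) (d - orbit w x)"
  using bij_betw_DiffI[OF assms(2) orbit_of_bij_betw(3)[OF assms]] orbit_of_bij_betw(2)[OF assms]
  by auto

lemma cyclic_type_cong: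
  assumes "bij_betw w d d" "\<And>x. x \<in> d \<Longrightarrow> w x = v x"
  shows "cyclic_type (d, w) = cyclic_type (d, v)"
proof -
  have "orbit w ` d = orbit v ` d"
    by (rule image_cong[OF refl], rule orbit_cong0) (use assms in \<open>auto dest: bij_betwE\<close>)
  then show ?thesis by (simp add: cyclic_type_def)
qed

lemma cyclic_type_Un:
  assumes "finite d1" "finite d2" "bij_betw w d1 d1" "bij_betw w d2 d2" "d1 \<inter> d2 = {}"
  shows "cyclic_type (d1 \<union> d2, w) = cyclic_type (d1, w) + cyclic_type (d2, w)"
proof -
  have "orbit w a \<noteq> orbit w b" if "a \<in> d1" "b \<in> d2" for a b
    using orbit_of_bij_betw(1,2)[OF assms(1,3) that(1)] orbit_of_bij_betw(2)[OF assms(2,4) that(2)]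
      assms(5) by blast
  then have "orbit w ` d1 \<inter> orbit w ` d2 = {}" by blast
  then show ?thesis
    using mset_set_Union[of "orbit w ` d1" "orbit w ` d2"] assms(1,2)
    by (simp add: cyclic_type_def flip: image_Un)
qed

lemma cyclic_type_orbit:
  assumes "finite d" "bij_betw w d d" "x \<in> d"
  shows "cyclic_type (orbit w x, w) = {#card (orbit w x)#}"
proof -
  have "orbit w ` orbit w x = {orbit w x}"
    using orbit_eq_of_mem[OF assms] orbit_of_bij_betw(1)[OF assms] by blast
  then show ?thesis by (simp add: cyclic_type_def)
qed

text \<open>
  This is the recursion behind all inductions over permutations below: one cycle is split off.
\<close>

lemma cyclic_type_remove_orbit:
  assumes "finite d" "bij_betw w d d" "x \<in> d"
  shows "cyclic_type (d, w) = add_mset (card (orbit w x)) (cyclic_type (d - orbit w x, w))"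
proof -
  have "d = orbit w x \<union> (d - orbit w x)"
    using orbit_of_bij_betw(2)[OF assms] by auto
  then have "cyclic_type (d, w) = cyclic_type (orbit w x \<union> (d - orbit w x), w)" by simp
  also have "\<dots> = cyclic_type (orbit w x, w) + cyclic_type (d - orbit w x, w)"
    using orbit_of_bij_betw[OF assms] bij_betw_minus_orbit[OF assms] assms(1)
    by (intro cyclic_type_Un) (auto intro: finite_subset)
  finally show ?thesis by (simp add: cyclic_type_orbit[OF assms])
qed

lemma degree_cyclic_type:
  assumes "finite d" "bij_betw w d d"
  shows "degree (cyclic_type (d, w)) = card d"
  using assms
proof (induction d rule: finite_psubset_induct)
  case (psubset d)
  show ?case
  proof (cases "d = {}")
    case True then show ?thesis by (simp add: cyclic_type_def)
  next
    case False
    then obtain x where x: "x \<in> d" by auto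
    note o = orbit_of_bij_betw[OF psubset.hyps psubset.prems x]
    have "d - orbit w x \<subset> d" using o(1) x by blast
    then show ?thesis
      using psubset.IH bij_betw_minus_orbit[OF psubset.hyps psubset.prems x]
        cyclic_type_remove_orbit[OF psubset.hyps psubset.prems x] o(2) psubset.hyps
      by (simp add: card_Diff_subset finite_subset card_mono)
  qed
qed

lemma zero_notin_cyclic_type:
  assumes "finite d" "bij_betw w d d"
  shows "0 \<notin># cyclic_type (d, w)"
proof -
  have "card (orbit w x) \<noteq> 0" if "x \<in> d" for x
    using orbit_of_bij_betw(1,2)[OF assms that] finite_subset[OF _ assms(1)] by auto
  then show ?thesis using assms(1) by (fastforce simp: cyclic_type_def)
qed

lemma cyclic_type_eq_empty_iff:
  "finite d \<Longrightarrow> cyclic_type (d, w) = {#} \<longleftrightarrow> d = {}"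
  by (simp add: cyclic_type_def mset_set_empty_iff)

text \<open>
  A conjugating bijection carries orbits to orbits of the same size.
\<close>

lemma cyclic_type_conjugate:
  assumes "finite d" "bij_betw g d d" "bij_betw j d d'" "\<And>x. x \<in> d \<Longrightarrow> j (g x) = w (j x)"
  shows "cyclic_type (d', w) = cyclic_type (d, g)"
proof -
  have inj: "inj_on j d" and im: "d' = j ` d"
    using assms(3) by (auto simp: bij_betw_def)
  have o: "orbit w (j x) = j ` orbit g x" if "x \<in> d" for x
  proof (rule orbit_inverse[symmetric])
    show "x \<in> orbit g x" by (rule orbit_of_bij_betw(1)[OF assms(1,2) that])
  next
    fix y assume "y \<in> orbit g x"
    then have "y \<in> d" using orbit_of_bij_betw(2)[OF assms(1,2) that] by auto
    then show "w (j y) = j (g y)" using assms(4) by simp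
  qed
  have "orbit w ` d' = (`) j ` (orbit g ` d)"
    unfolding im image_image by (rule image_cong) (simp_all add: o)
  moreover have "inj_on ((`) j) (orbit g ` d)"
    using inj orbit_of_bij_betw(2)[OF assms(1,2)] by (auto simp: inj_on_image_eq_iff intro!: inj_onI)
  ultimately have "mset_set (orbit w ` d') = image_mset ((`) j) (mset_set (orbit g ` d))"
    by (simp add: image_mset_mset_set)
  moreover have "card (j ` Q) = card Q" if "Q \<in> orbit g ` d" for Q
    using that inj orbit_of_bij_betw(2)[OF assms(1,2)] by (auto intro!: card_image intro: inj_on_subset)
  ultimately show ?thesis
    using assms(1)
    by (auto simp: cyclic_type_def multiset.map_comp intro!: image_mset_cong)
qed

text \<open>
  The cyclic shift of \<open>{..<n}\<close> is transported along an enumeration of \<open>d\<close>.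
\<close>

lemma ex_cyclic_permutation:
  assumes "finite d" "d \<noteq> {}"
  shows "\<exists>w. w permutes d \<and> cyclic_type (d, w) = {#card d#}"
proof -
  obtain cs where cs: "set cs = d" "distinct cs" using assms(1) finite_distinct_list by blast
  let ?n = "length cs"
  have n: "?n = card d" "0 < ?n" using cs assms distinct_card by (force, auto)
  have 1: "bij_betw (\<lambda>i. Suc i mod ?n) {..<?n} {..<?n}"
  proof -
    have "inj_on (\<lambda>i. Suc i mod ?n) {..<?n}"
      by (auto simp: inj_on_def mod_Suc split: if_splits)
    moreover have "(\<lambda>i. Suc i mod ?n) ` {..<?n} \<subseteq> {..<?n}" using n by auto
    ultimately show ?thesis by (auto simp: bij_betw_def endo_inj_surj)
  qed
  have 2: "cyclic_type ({..<?n}, \<lambda>i. Suc i mod ?n) = {#?n#}"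
  proof -
    let ?s = "\<lambda>i. Suc i mod ?n"
    have p: "(?s ^^ i) 0 = i" if "i < ?n" for i
      using that by (induction i) auto
    have z: "orbit ?s 0 \<subseteq> {..<?n}" "0 \<in> orbit ?s 0"
      using orbit_of_bij_betw(1,2)[OF _ 1, of 0] n by auto
    have "{..<?n} \<subseteq> orbit ?s 0"
      using funpow_in_orbit[OF z(2)] p by (metis lessThan_iff subsetI)
    then have "orbit ?s 0 = {..<?n}" using z by auto
    then show ?thesis
      using cyclic_type_orbit[OF _ 1, of 0] n by simp
  qed
  have 3: "bij_betw (nth cs) {..<?n} d"
    using cs by (auto intro: bij_betw_nth)
  define v where "v = (\<lambda>x. nth cs (Suc (inv_into {..<?n} (nth cs) x) mod ?n))"
  define w where "w = (\<lambda>x. if x \<in> d then v x else x)"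
  have "bij_betw (inv_into {..<?n} (nth cs)) d {..<?n}" using 3 by (rule bij_betw_inv_into)
  from bij_betw_trans[OF bij_betw_trans[OF this 1] 3]
  have v: "bij_betw v d d" by (simp add: v_def comp_def)
  then have "w permutes d"
    by (intro bij_imp_permutes) (auto simp: w_def cong: bij_betw_cong)
  moreover have "cyclic_type (d, w) = cyclic_type ({..<?n}, \<lambda>i. Suc i mod ?n)"
  proof (rule cyclic_type_conjugate[OF _ 1 3])
    fix i assume "i \<in> {..<?n}"
    moreover from this have "cs ! i \<in> d" using cs nth_mem by blast
    ultimately show "cs ! (Suc i mod ?n) = w (cs ! i)"
      using 3 by (simp add: w_def v_def bij_betw_inv_into_left)
  qed simp
  ultimately show ?thesis using 2 n by auto
qed

text \<open>
  The rows are realised one after the other by cycles on disjoint parts of \<open>d\<close>.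
\<close>

lemma ex_permutation_of_cyclic_type:
  assumes "finite d" "card d = degree \<Delta>" "0 \<notin># \<Delta>"
  shows "\<exists>w. w permutes d \<and> cyclic_type (d, w) = \<Delta>"
  using assms
proof (induction \<Delta> arbitrary: d)
  case empty
  then show ?case by (auto simp: cyclic_type_def intro!: exI[of _ id] permutes_id)
next
  case (add k \<Delta>)
  then obtain d1 where d1: "d1 \<subseteq> d" "card d1 = k"
    using obtain_subset_with_card_n[of k d] by auto
  have f: "finite d1" "finite (d - d1)" using d1 add.prems(1) finite_subset by auto
  have "d1 \<noteq> {}" using d1 add.prems(3) by auto
  then obtain w1 where w1: "w1 permutes d1" "cyclic_type (d1, w1) = {#k#}"
    using ex_cyclic_permutation[OF f(1)] d1 by auto
  have "card (d - d1) = degree \<Delta>"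
    using d1 f add.prems by (simp add: card_Diff_subset)
  then obtain w2 where w2: "w2 permutes (d - d1)" "cyclic_type (d - d1, w2) = \<Delta>"
    using add.IH[OF f(2)] add.prems by auto
  let ?w = "w1 \<circ> w2"
  have e1: "?w x = w1 x" if "x \<in> d1" for x
    using that w2(1) by (simp add: permutes_not_in)
  have e2: "?w x = w2 x" if "x \<in> d - d1" for x
    using that w2(1) w1(1) by (metis Diff_iff comp_apply permutes_in_image permutes_not_in)
  have b1: "bij_betw ?w d1 d1" and b2: "bij_betw ?w (d - d1) (d - d1)"
    using permutes_imp_bij[OF w1(1)] permutes_imp_bij[OF w2(1)]
      bij_betw_cong[of d1 ?w w1 d1] bij_betw_cong[of "d - d1" ?w w2 "d - d1"] e1 e2 by blast+
  have "?w permutes d"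
    by (rule permutes_compose) (use w1 w2 d1 in \<open>auto intro: permutes_subset\<close>)
  moreover have "cyclic_type (d1 \<union> (d - d1), ?w) = cyclic_type (d1, w1) + cyclic_type (d - d1, w2)"
    using cyclic_type_Un[OF f b1 b2 Diff_disjoint] cyclic_type_cong[of ?w d1 w1, OF b1 e1]
      cyclic_type_cong[of ?w "d - d1" w2, OF b2 e2] by metis
  moreover have "d1 \<union> (d - d1) = d" using d1 by auto
  ultimately show ?case using w1 w2 by auto
qed


section \<open>Counting conjugating bijections\<close>

text \<open>
  Restricting to extensional functions makes this set finite, so that its elements can be counted.
\<close>

definition conjugators :: "nat set \<Rightarrow> (nat \<Rightarrow> nat) \<Rightarrow> nat set \<Rightarrow> (nat \<Rightarrow> nat) \<Rightarrow> (nat \<Rightarrow> nat) set" where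
  "conjugators d g d' w = {j \<in> extensional d. bij_betw j d d' \<and> (\<forall>x\<in>d. j (g x) = w (j x))}"

text \<open>
  The order of the centralizer of a permutation of cyclic type \<open>\<Delta>\<close>; the inverse of \<open>\<kappa>(\<Delta>)\<close>.
\<close>

definition centralizer_size :: "nat multiset \<Rightarrow> nat" where
  "centralizer_size \<Delta> = (\<Prod>k\<in>set_mset \<Delta>. fact (count \<Delta> k) * k ^ count \<Delta> k)"

lemma centralizer_size_add_mset:
  "centralizer_size (add_mset k \<Delta>) = k * Suc (count \<Delta> k) * centralizer_size \<Delta>"
proof -
  let ?f = "\<lambda>\<Delta> i. fact (count \<Delta> i) * i ^ count \<Delta> i :: nat"
  let ?S = "insert k (set_mset \<Delta>)"
  have "centralizer_size (add_mset k \<Delta>) = prod (?f (add_mset k \<Delta>)) ?S"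
    by (simp add: centralizer_size_def)
  also have "\<dots> = ?f (add_mset k \<Delta>) k * prod (?f (add_mset k \<Delta>)) (?S - {k})"
    by (rule prod.remove) auto
  also have "prod (?f (add_mset k \<Delta>)) (?S - {k}) = prod (?f \<Delta>) (?S - {k})"
    by (rule prod.cong) auto
  also have "?f (add_mset k \<Delta>) k = k * Suc (count \<Delta> k) * ?f \<Delta> k"
    by (simp add: algebra_simps)
  finally have "centralizer_size (add_mset k \<Delta>) = k * Suc (count \<Delta> k) * (?f \<Delta> k * prod (?f \<Delta>) (?S - {k}))"
    by simp
  also have "?f \<Delta> k * prod (?f \<Delta>) (?S - {k}) = prod (?f \<Delta>) ?S"
    by (rule prod.remove[symmetric]) auto
  also have "\<dots> = centralizer_size \<Delta>"
    unfolding centralizer_size_def by (rule prod.mono_neutral_right) (auto simp: not_in_iff)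
  finally show ?thesis .
qed

text \<open>
  These points are the disjoint union of the orbits of size \<open>k\<close>.
\<close>

lemma card_points_in_cycles_of_length:
  assumes "finite d" "bij_betw w d d"
  shows "card {y \<in> d. card (orbit w y) = k} = k * count (cyclic_type (d, w)) k"
proof -
  let ?C = "{Q \<in> orbit w ` d. card Q = k}"
  have sub: "Q \<subseteq> d" if "Q \<in> ?C" for Q
    using that orbit_of_bij_betw(2)[OF assms] by auto
  have un: "{y \<in> d. card (orbit w y) = k} = \<Union>?C"
  proof (intro equalityI subsetI)
    fix y assume "y \<in> {y \<in> d. card (orbit w y) = k}"
    then show "y \<in> \<Union>?C" using orbit_of_bij_betw(1)[OF assms, of y] by blast
  next
    fix y assume "y \<in> \<Union>?C"
    then obtain x where "x \<in> d" "y \<in> orbit w x" "card (orbit w x) = k" by blast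
    then show "y \<in> {y \<in> d. card (orbit w y) = k}"
      using orbit_of_bij_betw(2)[OF assms, of x] orbit_eq_of_mem[OF assms, of x y] by auto
  qed
  have "pairwise disjnt ?C"
  proof (rule pairwiseI)
    fix P Q assume "P \<in> ?C" "Q \<in> ?C" "P \<noteq> Q"
    then obtain x y where "x \<in> d" "y \<in> d" "P = orbit w x" "Q = orbit w y" by blast
    then show "disjnt P Q"
      using orbit_eq_of_mem[OF assms] \<open>P \<noteq> Q\<close> unfolding disjnt_def by (metis disjoint_iff)
  qed
  then have "card (\<Union>?C) = (\<Sum>Q\<in>?C. card Q)"
    using sub assms(1) by (intro card_Union_disjoint) (auto intro: finite_subset)
  also have "\<dots> = k * card ?C" by simp
  also have "card ?C = count (cyclic_type (d, w)) k"
    using assms(1) by (auto simp: cyclic_type_def count_image_mset' intro!: arg_cong[of _ _ card])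
  finally show ?thesis unfolding un .
qed

text \<open>
  The bijection is \<open>g\<^sup>i x \<mapsto> w\<^sup>i y\<close>; it is compatible with the step that closes the cycle because both
  cycles have the same length.
\<close>

lemma ex_conjugator_of_orbits:
  fixes d d' :: "nat set"
  assumes d: "finite d" "bij_betw g d d" "x \<in> d" and d': "finite d'" "bij_betw w d' d'" "y \<in> d'"
    and card: "card (orbit g x) = card (orbit w y)"
  obtains h where "bij_betw h (orbit g x) (orbit w y)" "h x = y"
    "\<And>z. z \<in> orbit g x \<Longrightarrow> h (g z) = w (h z)"
proof -
  have card_orbit: "card (orbit f u) = funpow_dist1 f u u \<and> (f ^^ funpow_dist1 f u u) u = u"
    if "finite e" "bij_betw f e e" "u \<in> e" for f u and e :: "nat set"
  proof -
    note u = orbit_of_bij_betw(1)[OF that]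
    have "card (orbit f u) = card ((\<lambda>n. (f ^^ n) u) ` {0..<funpow_dist1 f u u})"
      by (rule arg_cong[OF orbit_conv_funpow_dist1[OF u]])
    also have "\<dots> = funpow_dist1 f u u"
      by (simp only: card_image[OF inj_on_funpow_dist1[OF u]] card_atLeastLessThan diff_zero)
    finally show ?thesis using funpow_dist1_prop[OF u] by blast
  qed
  note x = orbit_of_bij_betw(1)[OF d] and y = orbit_of_bij_betw(1)[OF d']
  define k where "k = funpow_dist1 g x x"
  have k': "funpow_dist1 w y y = k"
    using card_orbit[OF d] card_orbit[OF d'] card unfolding k_def by metis
  have gx: "bij_betw (\<lambda>i. (g ^^ i) x) {0..<k} (orbit g x)"
    unfolding bij_betw_def k_def
    using inj_on_funpow_dist1[OF x] orbit_conv_funpow_dist1[OF x] by (auto simp only:)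
  have wy: "bij_betw (\<lambda>i. (w ^^ i) y) {0..<k} (orbit w y)"
    unfolding bij_betw_def k'[symmetric]
    using inj_on_funpow_dist1[OF y] orbit_conv_funpow_dist1[OF y] by (auto simp only:)
  have kx: "(g ^^ k) x = x" and ky: "(w ^^ k) y = y" and kpos: "0 < k"
    using card_orbit[OF d] card_orbit[OF d'] unfolding k' k_def[symmetric] by (simp_all add: k_def)
  define h where "h = (\<lambda>z. (w ^^ inv_into {0..<k} (\<lambda>i. (g ^^ i) x) z) y)"
  have h: "h ((g ^^ i) x) = (w ^^ i) y" if "i < k" for i
    using bij_betw_inv_into_left[OF gx, of i] that by (simp add: h_def)
  show thesis
  proof
    show "bij_betw h (orbit g x) (orbit w y)"
      using bij_betw_trans[OF bij_betw_inv_into[OF gx] wy] by (simp add: h_def comp_def)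
    show "h x = y" using h[OF kpos] by simp
    fix z assume "z \<in> orbit g x"
    then have "z \<in> (\<lambda>i. (g ^^ i) x) ` {0..<k}"
      using gx by (simp add: bij_betw_def)
    then obtain i where i: "i < k" "z = (g ^^ i) x" by auto
    show "h (g z) = w (h z)"
    proof (cases "Suc i < k")
      case True
      then have "h (g ((g ^^ i) x)) = w ((w ^^ i) y)" using h[OF True] by simp
      then show ?thesis using h[OF i(1)] i(2) by simp
    next
      case False
      then have k: "k = Suc i" using i(1) by simp
      then have "g z = x" "w ((w ^^ i) y) = y" using i(2) kx ky by simp_all
      then show ?thesis using h[OF i(1)] i(2) h[OF kpos] by simp
    qed
  qed
qed

text \<open>
  A conjugating bijection is determined on the orbit of \<open>x\<close> by its value at \<open>x\<close>, and it restricts to a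
  conjugating bijection of the complements; conversely, any such bijection of the complements can be
  extended by the one between the orbits.
\<close>

lemma card_conjugators_with_value:
  assumes d: "finite d" "bij_betw g d d" "x \<in> d" and d': "finite d'" "bij_betw w d' d'" "y \<in> d'"
    and card: "card (orbit g x) = card (orbit w y)"
  shows "card {j \<in> conjugators d g d' w. j x = y} =
    card (conjugators (d - orbit g x) g (d' - orbit w y) w)"
proof -
  note o = orbit_of_bij_betw[OF d] and o' = orbit_of_bij_betw[OF d']
  obtain h where h: "bij_betw h (orbit g x) (orbit w y)" "h x = y"
    "\<And>z. z \<in> orbit g x \<Longrightarrow> h (g z) = w (h z)"
    using ex_conjugator_of_orbits[OF d d' card] by blast
  let ?O = "orbit g x" and ?P = "orbit w y"
  let ?A = "{j \<in> conjugators d g d' w. j x = y}"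
  let ?B = "conjugators (d - ?O) g (d' - ?P) w"
  have gin: "g z \<in> d - ?O" if "z \<in> d - ?O" for z
    using bij_betwE[OF bij_betw_minus_orbit[OF d]] that by blast
  have on_orbit: "j z = h z" if "j \<in> ?A" "z \<in> ?O" for j z
    using that(2)
  proof induction
    case base
    then show ?case using that(1) d(3) h(2) h(3)[OF o(1)] by (simp add: conjugators_def)
  next
    case (step z)
    then show ?case using that(1) o(2) h(3)[OF step(1)] by (auto simp: conjugators_def)
  qed
  have "bij_betw (\<lambda>j. restrict j (d - ?O)) ?A ?B"
  proof (rule bij_betw_byWitness[where f' = "\<lambda>j z. if z \<in> ?O then h z else j z"])
    show "\<forall>j\<in>?A. (\<lambda>z. if z \<in> ?O then h z else restrict j (d - ?O) z) = j"
      using on_orbit by (fastforce simp: conjugators_def extensional_def fun_eq_iff)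
    show "\<forall>j\<in>?B. restrict (\<lambda>z. if z \<in> ?O then h z else j z) (d - ?O) = j"
      by (auto simp: conjugators_def extensional_def fun_eq_iff)
    show "(\<lambda>j. restrict j (d - ?O)) ` ?A \<subseteq> ?B"
    proof
      fix f assume "f \<in> (\<lambda>j. restrict j (d - ?O)) ` ?A"
      then obtain j where j: "j \<in> ?A" "f = restrict j (d - ?O)" by blast
      have jb: "bij_betw j d d'" and jc: "\<And>z. z \<in> d \<Longrightarrow> j (g z) = w (j z)"
        using j(1) by (auto simp: conjugators_def)
      have "bij_betw j ?O ?P"
        using h(1) on_orbit[OF j(1)] by (simp cong: bij_betw_cong)
      then have "bij_betw j (d - ?O) (d' - ?P)"
        using bij_betw_DiffI[OF jb] o(2) o'(2) by simp
      then have "bij_betw f (d - ?O) (d' - ?P)"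
        unfolding j(2) by (subst bij_betw_cong[where g = j]) auto
      then show "f \<in> ?B"
        using jc gin j(2) by (auto simp: conjugators_def)
    qed
    show "(\<lambda>j z. if z \<in> ?O then h z else j z) ` ?B \<subseteq> ?A"
    proof
      fix f assume "f \<in> (\<lambda>j z. if z \<in> ?O then h z else j z) ` ?B"
      then obtain j where j: "j \<in> ?B" "f = (\<lambda>z. if z \<in> ?O then h z else j z)" by blast
      have "bij_betw j (d - ?O) (d' - ?P)" using j(1) by (simp add: conjugators_def)
      then have b1: "bij_betw f (d - ?O) (d' - ?P)"
        unfolding j(2) by (subst bij_betw_cong[where g = j]) auto
      have b2: "bij_betw f ?O ?P"
        using j(2) h(1) by (simp cong: bij_betw_cong)
      have "bij_betw f (?O \<union> (d - ?O)) (?P \<union> (d' - ?P))"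
        by (rule bij_betw_combine[OF b2 b1]) auto
      moreover have "?O \<union> (d - ?O) = d" "?P \<union> (d' - ?P) = d'" using o(2) o'(2) by auto
      ultimately have b: "bij_betw f d d'" by simp
      have "f (g z) = w (f z)" if "z \<in> d" for z
      proof (cases "z \<in> ?O")
        case True
        then show ?thesis using h(3) j(2) orbit.step[OF True] by simp
      next
        case False
        then have "z \<in> d - ?O" using that by blast
        then show ?thesis using gin[of z] j by (simp add: conjugators_def)
      qed
      moreover have "f \<in> extensional d"
        using j o(2) by (auto simp: conjugators_def extensional_def)
      moreover have "f x = y" using j(2) h(2) o(1) by simp
      ultimately show "f \<in> ?A" using b by (simp add: conjugators_def)
    qed
  qed
  then show ?thesis by (rule bij_betw_same_card)
qed

lemma finite_conjugators:
  assumes "finite d" "finite d'"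
  shows "finite (conjugators d g d' w)"
proof (rule finite_subset)
  show "conjugators d g d' w \<subseteq> d \<rightarrow>\<^sub>E d'"
    unfolding conjugators_def by (auto dest: bij_betwE simp: PiE_def)
  show "finite (d \<rightarrow>\<^sub>E d')" using assms by (intro finite_PiE) auto
qed

text \<open>
  Induction on \<open>d\<close>: for a point \<open>x\<close> in a cycle of length \<open>k\<close> the possible images are the points in
  \<open>k\<close>-cycles of \<open>w\<close>, and after the choice of the image there remain the bijections of the complements
  of the two cycles.  The numbers multiply in the same way as in \<open>centralizer_size_add_mset\<close>.
\<close>

lemma card_conjugators:
  assumes "finite d" "bij_betw g d d" "finite d'" "bij_betw w d' d'"
    and "cyclic_type (d', w) = cyclic_type (d, g)"
  shows "card (conjugators d g d' w) = centralizer_size (cyclic_type (d, g))"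
  using assms
proof (induction d arbitrary: d' rule: finite_psubset_induct)
  case (psubset d)
  note b = psubset.prems(1) and f' = psubset.prems(2) and b' = psubset.prems(3)
    and eq = psubset.prems(4)
  show ?case
  proof (cases "d = {}")
    case True
    then have "d' = {}" using eq f' by (metis cyclic_type_eq_empty_iff finite.emptyI)
    then have "conjugators d g d' w = {\<lambda>x. undefined}"
      using True by (auto simp: conjugators_def bij_betw_def)
    then show ?thesis using True by (simp add: cyclic_type_def centralizer_size_def)
  next
    case False
    then obtain x where x: "x \<in> d" by auto
    let ?k = "card (orbit g x)" and ?\<Delta> = "cyclic_type (d - orbit g x, g)"
    let ?Y = "{y \<in> d'. card (orbit w y) = ?k}"
    note o = orbit_of_bij_betw[OF psubset.hyps b x]
    have rem: "cyclic_type (d, g) = add_mset ?k ?\<Delta>"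
      by (rule cyclic_type_remove_orbit[OF psubset.hyps b x])
    have in_Y: "j x \<in> ?Y" if "j \<in> conjugators d g d' w" for j
    proof -
      have j: "bij_betw j d d'" "\<And>z. z \<in> d \<Longrightarrow> j (g z) = w (j z)"
        using that by (auto simp: conjugators_def)
      have "j ` orbit g x = orbit w (j x)"
        using o(2) j(2) by (intro orbit_inverse[OF o(1)]) auto
      moreover have "card (j ` orbit g x) = ?k"
        using j(1) o(2) by (intro card_image) (auto simp: bij_betw_def intro: inj_on_subset)
      ultimately show ?thesis using j(1) x by (auto dest: bij_betwE)
    qed
    have fib: "card {j \<in> conjugators d g d' w. j x = y} = centralizer_size ?\<Delta>" if "y \<in> ?Y" for y
    proof -
      have y: "y \<in> d'" "?k = card (orbit w y)" using that by auto
      have "card {j \<in> conjugators d g d' w. j x = y} =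
          card (conjugators (d - orbit g x) g (d' - orbit w y) w)"
        by (rule card_conjugators_with_value[OF psubset.hyps b x f' b' y])
      also have "\<dots> = centralizer_size ?\<Delta>"
      proof (rule psubset.IH)
        show "d - orbit g x \<subset> d" using o(1) x by blast
        show "bij_betw g (d - orbit g x) (d - orbit g x)"
          by (rule bij_betw_minus_orbit[OF psubset.hyps b x])
        show "finite (d' - orbit w y)" using f' by simp
        show "bij_betw w (d' - orbit w y) (d' - orbit w y)"
          by (rule bij_betw_minus_orbit[OF f' b' y(1)])
        show "cyclic_type (d' - orbit w y, w) = ?\<Delta>"
          using cyclic_type_remove_orbit[OF f' b' y(1)] rem eq y(2) by simp
      qed
      finally show ?thesis .
    qed
    have "conjugators d g d' w = (\<Union>y\<in>?Y. {j \<in> conjugators d g d' w. j x = y})"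
      using in_Y by auto
    then have "card (conjugators d g d' w) = card (\<Union>y\<in>?Y. {j \<in> conjugators d g d' w. j x = y})"
      by simp
    also have "\<dots> = (\<Sum>y\<in>?Y. card {j \<in> conjugators d g d' w. j x = y})"
      using f' finite_conjugators[OF psubset.hyps f'] by (intro card_UN_disjoint) auto
    also have "\<dots> = card ?Y * centralizer_size ?\<Delta>" using fib by simp
    also have "card ?Y = ?k * count (cyclic_type (d, g)) ?k"
      using card_points_in_cycles_of_length[OF f' b'] eq by simp
    finally show ?thesis unfolding rem by (simp add: centralizer_size_add_mset)
  qed
qed

lemma centralizer_size_pos:
  assumes "0 \<notin># \<Delta>"
  shows "centralizer_size \<Delta> > 0"
  unfolding centralizer_size_def
proof (rule prod_pos)
  fix k assume "k \<in># \<Delta>"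
  with assms have "k > 0" by (metis gr0I)
  then show "fact (count \<Delta> k) * k ^ count \<Delta> k > 0" by simp
qed


section \<open>Polynomials and normally ordered operators\<close>

abbreviation pol_linear :: "operator \<Rightarrow> bool" where
  "pol_linear \<equiv> linear_map_on (\<lambda>c f. pol_const c * f) (\<lambda>c f. pol_const c * f) UNIV"

text \<open>
  Products indexed by a finite set of labels, rather than monomials as exponent functions: repeated
  variables keep their own labels, and permutations act on the labels.
\<close>

definition X_prod :: "nat set \<Rightarrow> (nat \<Rightarrow> nat \<times> nat) \<Rightarrow> pol" where
  "X_prod I u = (\<Prod>i\<in>I. X (u i))"

lemma X_prod_eq_single:
  "finite I \<Longrightarrow> X_prod I u = Poly_Mapping.single (\<Sum>i\<in>I. Poly_Mapping.single (u i) 1) 1"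
  by (induction I rule: finite_induct) (simp_all add: X_prod_def X_def mult_single)

text \<open>
  Every monomial is a product of variables, written as a list and labelled by the positions in it.
\<close>

lemma single_eq_X_prod:
  "\<exists>I u. finite I \<and> Poly_Mapping.single m 1 = X_prod I u"
proof -
  have "\<exists>vs. Poly_Mapping.single m (1::complex) = prod_list (map X vs)"
  proof (induction m rule: update_induct)
    case const
    show ?case by (rule exI[of _ "[]"]) simp
  next
    case (update m v k)
    then obtain vs where vs: "Poly_Mapping.single m (1::complex) = prod_list (map X vs)" by blast
    have "Poly_Mapping.update v k m = m + Poly_Mapping.single v k"
      using update(1) by (intro poly_mapping_eqI)
        (auto simp: lookup_update lookup_add lookup_single in_keys_iff)
    moreover have "Poly_Mapping.single (Poly_Mapping.single v k) (1::complex) = X v ^ k"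
    proof (induction k)
      case (Suc k)
      have "X v ^ Suc k = X v * Poly_Mapping.single (Poly_Mapping.single v k) 1" by (simp add: Suc)
      also have "\<dots> = Poly_Mapping.single (Poly_Mapping.single v 1 + Poly_Mapping.single v k) 1"
        by (simp only: X_def mult_single mult_1)
      also have "Poly_Mapping.single v 1 + Poly_Mapping.single v k = Poly_Mapping.single v (Suc k)"
        by (simp flip: single_add)
      finally show ?case by (rule sym)
    qed simp
    moreover have "Poly_Mapping.single (m + Poly_Mapping.single v k) (1::complex) =
        Poly_Mapping.single m 1 * Poly_Mapping.single (Poly_Mapping.single v k) 1"
      by (simp only: mult_single mult_1)
    ultimately have "Poly_Mapping.single (Poly_Mapping.update v k m) (1::complex)
        = prod_list (map X (vs @ replicate k v))"
      by (simp only: vs map_append prod_list.append map_replicate prod_list_replicate)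
    then show ?case by blast
  qed
  then obtain vs where vs: "Poly_Mapping.single m (1::complex) = prod_list (map X vs)" by blast
  have "prod_list (map X vs) = X_prod {..<length vs} (nth vs)"
    by (simp add: X_prod_def prod.list_conv_set_nth atLeast0LessThan)
  with vs show ?thesis by (metis finite_lessThan)
qed

lemma lookup_pol_const_mult:
  "Poly_Mapping.lookup (pol_const c * f) m = c * Poly_Mapping.lookup f m"
  unfolding pol_const_def mult_map_scale_conv_mult[symmetric] by (simp add: map.rep_eq when_def)

lemma pol_const_mult_single:
  "pol_const c * Poly_Mapping.single m a = Poly_Mapping.single m (c * a)"
  by (simp add: pol_const_def mult_single)

lemma pol_induct [case_names X_prod add scale]:
  assumes "\<And>I u. finite I \<Longrightarrow> P (X_prod I u)" "\<And>f g. P f \<Longrightarrow> P g \<Longrightarrow> P (f + g)"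
    "\<And>c f. P f \<Longrightarrow> P (pol_const c * f)"
  shows "P f"
proof (induction f rule: update_induct)
  case const
  have "P (pol_const 0 * X_prod {} (\<lambda>_. (0, 0)))" by (intro assms) simp
  then show ?case by (simp add: pol_const_def)
next
  case (update f m c)
  have "Poly_Mapping.update m c f = f + pol_const c * Poly_Mapping.single m 1"
    using update(1) by (intro poly_mapping_eqI)
      (auto simp: lookup_update lookup_add lookup_single in_keys_iff lookup_pol_const_mult)
  moreover have "P (Poly_Mapping.single m 1)"
    using single_eq_X_prod[of m] assms(1) by metis
  ultimately show ?case using update assms by simp
qed

lemma pol_linear_add: "pol_linear T \<Longrightarrow> T (f + g) = T f + T g"
  and pol_linear_scale: "pol_linear T \<Longrightarrow> T (pol_const c * f) = pol_const c * T f"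
  by (simp_all add: linear_map_on_def)

lemma pol_linear_zero: "pol_linear T \<Longrightarrow> T 0 = 0"
  using pol_linear_scale[of T 0 0] by (simp add: pol_const_def)

lemma pol_linear_sum: "pol_linear T \<Longrightarrow> T (sum f A) = (\<Sum>i\<in>A. T (f i))"
  by (induction A rule: infinite_finite_induct) (simp_all add: pol_linear_zero pol_linear_add)

lemma pol_linear_eqI:
  assumes "pol_linear S" "pol_linear T" "\<And>I u. finite I \<Longrightarrow> S (X_prod I u) = T (X_prod I u)"
  shows "S = T"
proof
  show "S f = T f" for f
    by (induction f rule: pol_induct)
      (simp_all add: assms(3) pol_linear_add[OF assms(1)] pol_linear_add[OF assms(2)]
        pol_linear_scale[OF assms(1)] pol_linear_scale[OF assms(2)])
qed

lemma pol_linear_comp: "pol_linear S \<Longrightarrow> pol_linear T \<Longrightarrow> pol_linear (S \<circ> T)"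
  by (simp add: linear_map_on_def)

lemma pol_linear_id: "pol_linear id"
  by (simp add: linear_map_on_def)

lemma pol_linear_mult: "pol_linear T \<Longrightarrow> pol_linear (\<lambda>f. g * T f)"
  by (simp add: linear_map_on_def algebra_simps)

lemma pol_linear_when: "pol_linear T \<Longrightarrow> pol_linear (\<lambda>f. T f when P)"
  by (simp add: linear_map_on_def when_def)

lemma pol_linear_plus: "pol_linear S \<Longrightarrow> pol_linear T \<Longrightarrow> pol_linear (S + T)"
  by (simp add: linear_map_on_def algebra_simps)

lemma pol_linear_op_scale: "pol_linear T \<Longrightarrow> pol_linear (op_scale c T)"
  unfolding op_scale_def by (rule pol_linear_mult)

lemma finite_support_of_pol_linear_family:
  assumes "\<And>i. pol_linear (T i)" "\<And>I u. finite I \<Longrightarrow> finite {i. T i (X_prod I u) \<noteq> 0}"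
  shows "finite {i. T i f \<noteq> 0}"
proof (induction f rule: pol_induct)
  case (X_prod I u)
  then show ?case by (rule assms(2))
next
  case (add f g)
  then show ?case
    by (rule_tac finite_subset[of _ "{i. T i f \<noteq> 0} \<union> {i. T i g \<noteq> 0}"])
      (auto simp: pol_linear_add[OF assms(1)])
next
  case (scale c f)
  then show ?case
    by (rule_tac finite_subset[of _ "{i. T i f \<noteq> 0}"]) (auto simp: pol_linear_scale[OF assms(1)])
qed

text \<open>
  An infinite sum of operators is linear only if it is finite at each polynomial, because the
  unrestricted sum takes the default value 0 otherwise.  It suffices to check finiteness on products of variables.
\<close>

lemma pol_linear_Sum_any:
  assumes "\<And>i. pol_linear (T i)" "\<And>I u. finite I \<Longrightarrow> finite {i. T i (X_prod I u) \<noteq> 0}"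
  shows "pol_linear (\<lambda>f. Sum_any (\<lambda>i. T i f))"
proof -
  note fin = finite_support_of_pol_linear_family[of T, OF assms]
  have "Sum_any (\<lambda>i. T i (f + g)) = Sum_any (\<lambda>i. T i f) + Sum_any (\<lambda>i. T i g)" for f g
    using Sum_any.distrib[OF fin fin] by (simp add: pol_linear_add[OF assms(1)])
  moreover have "Sum_any (\<lambda>i. T i (pol_const c * f)) = pol_const c * Sum_any (\<lambda>i. T i f)" for c f
    using Sum_any_right_distrib[OF fin] by (simp add: pol_linear_scale[OF assms(1)])
  ultimately show ?thesis unfolding linear_map_on_def by blast
qed

lemma partial_eq_sum_superset:
  assumes "finite S" "Poly_Mapping.keys f \<subseteq> S"
  shows "partial v f = (\<Sum>m\<in>S. Poly_Mapping.single (m - Poly_Mapping.single v 1)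
    (of_nat (Poly_Mapping.lookup m v) * Poly_Mapping.lookup f m))"
  unfolding partial_def using assms
  by (intro sum.mono_neutral_left) (auto simp: in_keys_iff)

lemma pol_linear_partial: "pol_linear (partial v)"
  unfolding linear_map_on_def
proof (intro conjI allI ballI)
  fix f g :: pol
  let ?S = "Poly_Mapping.keys f \<union> Poly_Mapping.keys g \<union> Poly_Mapping.keys (f + g)"
  show "partial v (f + g) = partial v f + partial v g"
    by (subst (1 2 3) partial_eq_sum_superset[of ?S])
      (auto simp: lookup_add algebra_simps single_add simp flip: sum.distrib)
next
  fix c and f :: pol
  let ?S = "Poly_Mapping.keys f \<union> Poly_Mapping.keys (pol_const c * f)"
  show "partial v (pol_const c * f) = pol_const c * partial v f"
    by (subst (1 2) partial_eq_sum_superset[of ?S])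
      (simp_all add: lookup_pol_const_mult sum_distrib_left pol_const_mult_single mult.left_commute)
qed

text \<open>
  The exponent of \<open>v\<close> in the monomial counts the factors equal to \<open>v\<close>, and removing any of them gives
  the same monomial.
\<close>

lemma partial_X_prod:
  assumes "finite I"
  shows "partial v (X_prod I u) = (\<Sum>j\<in>{j\<in>I. u j = v}. X_prod (I - {j}) u)"
proof -
  let ?m = "\<Sum>i\<in>I. Poly_Mapping.single (u i) (1::nat)"
  have "Poly_Mapping.lookup ?m v = (\<Sum>i\<in>I. if u i = v then 1 else 0)"
    unfolding lookup_sum by (rule sum.cong) (auto simp: lookup_single when_def)
  also have "\<dots> = card {j\<in>I. u j = v}"
    using assms by (simp add: sum.If_cases Int_def)
  finally have m: "Poly_Mapping.lookup ?m v = card {j\<in>I. u j = v}" .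
  have rest: "X_prod (I - {j}) u = Poly_Mapping.single (?m - Poly_Mapping.single v 1) 1"
    if "j \<in> {j\<in>I. u j = v}" for j
  proof -
    have "?m = Poly_Mapping.single v 1 + (\<Sum>i\<in>I - {j}. Poly_Mapping.single (u i) 1)"
      using that assms by (simp add: sum.remove[of I j])
    then show ?thesis using assms by (simp add: X_prod_eq_single)
  qed
  have "partial v (X_prod I u) =
      Poly_Mapping.single (?m - Poly_Mapping.single v 1) (of_nat (card {j\<in>I. u j = v}))"
    using m assms by (simp add: X_prod_eq_single partial_def)
  also have "\<dots> = of_nat (card {j\<in>I. u j = v}) * Poly_Mapping.single (?m - Poly_Mapping.single v 1) 1"
    by (simp add: mult_single flip: single_of_nat)
  also have "\<dots> = (\<Sum>j\<in>{j\<in>I. u j = v}. X_prod (I - {j}) u)"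
    by (simp add: rest)
  finally show ?thesis .
qed

definition injective_lists :: "nat set \<Rightarrow> nat \<Rightarrow> nat list set" where
  "injective_lists I n = {js. distinct js \<and> set js \<subseteq> I \<and> length js = n}"

lemma finite_injective_lists: "finite I \<Longrightarrow> finite (injective_lists I n)"
  by (rule finite_subset[OF _ finite_lists_length_eq[of I n]]) (auto simp: injective_lists_def)

text \<open>
  Iterated derivatives delete distinct factors one after the other; the list \<open>js\<close> records which.
\<close>

lemma foldr_partial_X_prod:
  assumes "finite I"
  shows "foldr partial vs (X_prod I u) =
    (\<Sum>js\<in>{js \<in> injective_lists I (length vs). map u js = vs}. X_prod (I - set js) u)"
proof (induction vs)
  case Nil
  have "{js \<in> injective_lists I 0. map u js = []} = {[]}" by (auto simp: injective_lists_def)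
  then show ?case by simp
next
  case (Cons v vs)
  let ?S = "{js \<in> injective_lists I (length vs). map u js = vs}"
  let ?T = "\<lambda>js. {j \<in> I - set js. u j = v}"
  have fin: "finite ?S" "\<And>js. finite (?T js)"
    using assms by (simp_all add: finite_injective_lists)
  have "foldr partial (v # vs) (X_prod I u) = (\<Sum>js\<in>?S. partial v (X_prod (I - set js) u))"
    by (simp add: Cons.IH pol_linear_sum[OF pol_linear_partial])
  also have "\<dots> = (\<Sum>js\<in>?S. \<Sum>j\<in>?T js. X_prod (I - set js - {j}) u)"
    using assms by (simp add: partial_X_prod)
  also have "\<dots> = (\<Sum>(js, j)\<in>Sigma ?S ?T. X_prod (I - set js - {j}) u)"
    using fin by (simp add: sum.Sigma)
  also have "\<dots> = (\<Sum>js\<in>{js \<in> injective_lists I (length (v # vs)). map u js = v # vs}.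
      X_prod (I - set js) u)"
  proof (rule sum.reindex_bij_witness[of _ "\<lambda>js. (tl js, hd js)" "\<lambda>(js, j). j # js"])
    fix p assume "p \<in> Sigma ?S ?T"
    then show "(\<lambda>(js, j). j # js) p \<in> {js \<in> injective_lists I (length (v # vs)). map u js = v # vs}"
      "(tl ((\<lambda>(js, j). j # js) p), hd ((\<lambda>(js, j). j # js) p)) = p"
      "X_prod (I - set ((\<lambda>(js, j). j # js) p)) u = (\<lambda>(js, j). X_prod (I - set js - {j}) u) p"
      by (auto simp: injective_lists_def intro!: arg_cong2[of _ _ _ _ X_prod])
  next
    fix js assume "js \<in> {js \<in> injective_lists I (length (v # vs)). map u js = v # vs}"
    then show "(\<lambda>(js, j). j # js) (tl js, hd js) = js" "(tl js, hd js) \<in> Sigma ?S ?T"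
      by (cases js; auto simp: injective_lists_def)+
  qed
  finally show ?case .
qed

lemma pol_linear_foldr_partial: "pol_linear (foldr partial vs)"
proof (induction vs)
  case Nil
  show ?case using pol_linear_id by (simp add: id_def)
next
  case (Cons v vs)
  show ?case using pol_linear_comp[OF pol_linear_partial Cons.IH] by (simp add: comp_def)
qed

text \<open>
  Only finitely many summands in the definition of \<open>normal_D\<close> act nontrivially on a given
  product: the column indices have to be those of factors that are present.
\<close>

lemma normal_D_summand_nonzero:
  assumes "finite I" "length as = length bs"
    "(prod_list (map X (zip as es)) * foldr partial (zip bs es) (X_prod I u) when length es = length as) \<noteq> 0"
  shows "\<exists>js \<in> injective_lists I (length as). map (fst \<circ> u) js = bs \<and> map (snd \<circ> u) js = es"
proof -
  have len: "length es = length as" and "foldr partial (zip bs es) (X_prod I u) \<noteq> 0"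
    using assms(3) by auto
  then obtain js where "js \<in> injective_lists I (length (zip bs es))" "map u js = zip bs es"
    unfolding foldr_partial_X_prod[OF assms(1)] using sum.not_neutral_contains_not_neutral by blast
  moreover from this have "map fst (map u js) = bs" "map snd (map u js) = es"
    using len assms(2) by simp_all
  then have "map (fst \<circ> u) js = bs" "map (snd \<circ> u) js = es" by simp_all
  ultimately show ?thesis using len assms(2) by (intro bexI[of _ js]) simp_all
qed

lemma pol_linear_normal_D:
  assumes "length as = length bs"
  shows "pol_linear (normal_D as bs)"
proof -
  have "pol_linear (\<lambda>f. Sum_any (\<lambda>es.
     prod_list (map X (zip as es)) * foldr partial (zip bs es) f when length es = length as))"
  proof (rule pol_linear_Sum_any)
    show "pol_linear (\<lambda>f. prod_list (map X (zip as es)) * foldr partial (zip bs es) f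
        when length es = length as)" for es
      by (intro pol_linear_when pol_linear_mult pol_linear_foldr_partial)
  next
    fix I :: "nat set" and u :: "nat \<Rightarrow> nat \<times> nat"
    assume I: "finite I"
    let ?A = "{es. (prod_list (map X (zip as es)) * foldr partial (zip bs es) (X_prod I u)
        when length es = length as) \<noteq> 0}"
    have "?A \<subseteq> map (snd \<circ> u) ` injective_lists I (length as)"
    proof
      fix es assume "es \<in> ?A"
      from normal_D_summand_nonzero[OF I assms CollectD[OF this]]
      show "es \<in> map (snd \<circ> u) ` injective_lists I (length as)" by auto
    qed
    then show "finite ?A"
      by (rule finite_subset) (intro finite_imageI finite_injective_lists I)
  qed
  then show ?thesis by (simp add: normal_D_def[abs_def])
qed

text \<open>
  Summing over all column indices \<open>es\<close> removes the condition on the columns of the deleted factors: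
  each list \<open>js\<close> whose rows are \<open>bs\<close> contributes to exactly one \<open>es\<close>.
\<close>

lemma normal_D_X_prod:
  assumes "finite I" "length as = length bs"
  shows "normal_D as bs (X_prod I u) =
    (\<Sum>js\<in>{js \<in> injective_lists I (length as). map (fst \<circ> u) js = bs}.
      prod_list (map X (zip as (map (snd \<circ> u) js))) * X_prod (I - set js) u)"
proof -
  let ?S = "{js \<in> injective_lists I (length as). map (fst \<circ> u) js = bs}"
  let ?E = "map (snd \<circ> u) ` injective_lists I (length as)"
  let ?h = "\<lambda>js. prod_list (map X (zip as (map (snd \<circ> u) js))) * X_prod (I - set js) u"
  let ?g = "\<lambda>es. prod_list (map X (zip as es)) * foldr partial (zip bs es) (X_prod I u)
    when length es = length as"
  have finE: "finite ?E" using finite_injective_lists[OF assms(1)] by simp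
  have finS: "finite ?S" using finite_injective_lists[OF assms(1)] by simp
  have supp: "{es. ?g es \<noteq> 0} \<subseteq> ?E"
  proof
    fix es assume "es \<in> {es. ?g es \<noteq> 0}"
    from normal_D_summand_nonzero[OF assms CollectD[OF this]] show "es \<in> ?E" by auto
  qed
  have "normal_D as bs (X_prod I u) = (\<Sum>es\<in>?E. ?g es)"
    unfolding normal_D_def by (rule Sum_any.expand_superset[OF finE supp])
  also have "\<dots> = (\<Sum>es\<in>?E. \<Sum>js\<in>{js \<in> ?S. map (snd \<circ> u) js = es}. ?h js)"
  proof (rule sum.cong[OF refl])
    fix es assume "es \<in> ?E"
    then have len: "length es = length as" by (auto simp: injective_lists_def)
    have iff: "map u js = zip bs es \<longleftrightarrow> map (fst \<circ> u) js = bs \<and> map (snd \<circ> u) js = es"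
      if "length js = length as" for js
    proof -
      have "map u js = zip (map (fst \<circ> u) js) (map (snd \<circ> u) js)"
        by (rule nth_equalityI) simp_all
      moreover have "length bs = length es" using len assms(2) by simp
      ultimately show ?thesis using that len
        by (metis length_map zip_eq_conv)
    qed
    have "{js \<in> injective_lists I (length (zip bs es)). map u js = zip bs es} =
        {js \<in> ?S. map (snd \<circ> u) js = es}"
      using iff len assms(2) by (auto simp: injective_lists_def)
    then show "?g es = (\<Sum>js\<in>{js \<in> ?S. map (snd \<circ> u) js = es}. ?h js)"
      using len by (auto simp: foldr_partial_X_prod[OF assms(1)] sum_distrib_left intro!: sum.cong)
  qed
  also have "\<dots> = (\<Sum>js\<in>?S. ?h js)"
    by (rule sum.group[OF finS finE]) auto
  finally show ?thesis .
qed


section \<open>The operators of Young diagrams permute row indices\<close>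

definition permutations_within :: "nat set \<Rightarrow> fperm set" where
  "permutations_within I = {p \<in> finite_permutations. fst p \<subseteq> I}"

text \<open>
  The inverse makes this a left action.
\<close>

definition permute_rows :: "(nat \<Rightarrow> nat) \<Rightarrow> (nat \<Rightarrow> nat \<times> nat) \<Rightarrow> nat \<Rightarrow> nat \<times> nat" where
  "permute_rows w u = (\<lambda>i. (fst (u (inv w i)), snd (u i)))"

text \<open>
  The permutation of the positions of \<open>js\<close> given by \<open>g\<close>, transported to the entries.
\<close>

definition induced_permutation :: "(nat \<Rightarrow> nat) \<Rightarrow> nat list \<Rightarrow> nat \<Rightarrow> nat" where
  "induced_permutation g js =
    (\<lambda>x. if x \<in> set js then js ! g (inv_into {..<length js} (nth js) x) else x)"

lemma finite_permutations_within:
  assumes "finite I"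
  shows "finite (permutations_within I)"
proof (rule finite_subset)
  show "permutations_within I \<subseteq> (SIGMA d:Pow I. {w. w permutes d})"
    by (auto simp: permutations_within_def finite_permutations_def)
  show "finite (SIGMA d:Pow I. {w. w permutes d})"
    using assms by (auto intro!: finite_SigmaI Permutations.finite_permutations intro: finite_subset)
qed

text \<open>
  The normally ordered product of traces attached to \<open>g\<close>, before division by the order of the
  centralizer.
\<close>

definition trace_operator :: "(nat \<Rightarrow> nat) \<Rightarrow> nat \<Rightarrow> operator" where
  "trace_operator g n f =
    Sum_any (\<lambda>as. normal_D as (map (\<lambda>i. as ! g i) [0..<n]) f when length as = n)"

context
  fixes g :: "nat \<Rightarrow> nat" and n :: nat
  assumes g: "g permutes {..<n}"
begin

lemma induced_permutation_nth:
  assumes "distinct js" "length js = n" "i < n"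
  shows "induced_permutation g js (js ! i) = js ! g i"
proof -
  have "inv_into {..<length js} (nth js) (js ! i) = i"
    using assms by (intro inv_into_f_f) (auto simp: inj_on_nth)
  then show ?thesis using assms by (simp add: induced_permutation_def)
qed

lemma induced_permutation_permutes:
  assumes "distinct js" "length js = n"
  shows "induced_permutation g js permutes set js"
proof (rule bij_imp_permutes)
  have b: "bij_betw (nth js) {..<n} (set js)" using assms by (auto intro: bij_betw_nth)
  have "bij_betw (nth js \<circ> g \<circ> inv_into {..<n} (nth js)) (set js) (set js)"
    by (intro bij_betw_trans[of _ _ "{..<n}"] bij_betw_inv_into b permutes_imp_bij[OF g])
  then show "bij_betw (induced_permutation g js) (set js) (set js)"
    by (rule bij_betw_cong[THEN iffD1, rotated]) (simp add: induced_permutation_def assms)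
qed (simp add: induced_permutation_def)

lemma induced_permutation_eqI:
  assumes "distinct js" "length js = n" "w permutes set js" "\<And>i. i < n \<Longrightarrow> js ! g i = w (js ! i)"
  shows "induced_permutation g js = w"
proof
  fix x
  show "induced_permutation g js x = w x"
  proof (cases "x \<in> set js")
    case True
    then obtain i where "i < n" "x = js ! i" using assms(2) by (metis in_set_conv_nth)
    then show ?thesis using assms(1,2,4) induced_permutation_nth by simp
  next
    case False
    then show ?thesis using assms(3) by (simp add: induced_permutation_def permutes_not_in)
  qed
qed

lemma inv_induced_permutation_nth:
  assumes "distinct js" "length js = n" "i < n"
  shows "inv (induced_permutation g js) (js ! i) = js ! inv g i"
proof -
  have "inv g i < n" using permutes_in_image[OF permutes_inv[OF g], of i] assms(3) by simp
  moreover have "g (inv g i) = i" using permutes_inverses(1)[OF g] .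
  ultimately have "induced_permutation g js (js ! inv g i) = js ! i"
    using induced_permutation_nth[OF assms(1,2), of "inv g i"] by simp
  then show ?thesis
    using permutes_inv_eq[OF induced_permutation_permutes[OF assms(1,2)]] by blast
qed

lemma cyclic_type_induced_permutation:
  assumes "distinct js" "length js = n"
  shows "cyclic_type (set js, induced_permutation g js) = cyclic_type ({..<n}, g)"
  using assms induced_permutation_nth
  by (intro cyclic_type_conjugate[where j = "nth js"] permutes_imp_bij[OF g] bij_betw_nth) auto

text \<open>
  A list inducing \<open>w\<close> is the list of values of a bijection that conjugates \<open>g\<close> to \<open>w\<close>.
\<close>

lemma card_lists_inducing:
  assumes "finite d" "d \<subseteq> I" "w permutes d" "cyclic_type (d, w) = cyclic_type ({..<n}, g)"
  shows "card {js \<in> injective_lists I n. (set js, induced_permutation g js) = (d, w)} =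
    centralizer_size (cyclic_type ({..<n}, g))"
proof -
  let ?A = "{js \<in> injective_lists I n. (set js, induced_permutation g js) = (d, w)}"
  let ?B = "conjugators {..<n} g d w"
  have "bij_betw (\<lambda>js. restrict (nth js) {..<n}) ?A ?B"
  proof (rule bij_betw_byWitness[where f' = "\<lambda>j. map j [0..<n]"])
    show "\<forall>js\<in>?A. map (restrict (nth js) {..<n}) [0..<n] = js"
      by (auto simp: injective_lists_def intro!: nth_equalityI)
    show "\<forall>j\<in>?B. restrict (nth (map j [0..<n])) {..<n} = j"
      by (auto simp: conjugators_def extensional_def fun_eq_iff)
    show "(\<lambda>js. restrict (nth js) {..<n}) ` ?A \<subseteq> ?B"
    proof
      fix j assume "j \<in> (\<lambda>js. restrict (nth js) {..<n}) ` ?A"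
      then obtain js where js: "js \<in> ?A" "j = restrict (nth js) {..<n}" by blast
      have d: "distinct js" "length js = n" "set js = d" "induced_permutation g js = w"
        using js(1) by (auto simp: injective_lists_def)
      have "bij_betw j {..<n} d"
        unfolding js(2) using bij_betw_nth[OF d(1), of "{..<n}" d] d
        by (subst bij_betw_cong[where g = "nth js"]) auto
      moreover have "j (g i) = w (j i)" if "i < n" for i
        using induced_permutation_nth[OF d(1,2) that] d(4) permutes_in_image[OF g, of i] that js(2)
        by simp
      ultimately show "j \<in> ?B" using js(2) by (simp add: conjugators_def)
    qed
    show "(\<lambda>j. map j [0..<n]) ` ?B \<subseteq> ?A"
    proof
      fix js assume "js \<in> (\<lambda>j. map j [0..<n]) ` ?B"
      then obtain j where j: "bij_betw j {..<n} d" "\<And>i. i < n \<Longrightarrow> j (g i) = w (j i)"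
        and js: "js = map j [0..<n]"
        by (auto simp: conjugators_def)
      have d: "distinct js" "length js = n" "set js = d"
        using j(1) by (auto simp: js distinct_map bij_betw_def atLeast0LessThan)
      have "induced_permutation g js = w"
        using d assms(3) j(2) permutes_in_image[OF g] by (intro induced_permutation_eqI) (auto simp: js)
      then show "js \<in> ?A" using d assms(2) by (simp add: injective_lists_def)
    qed
  qed
  then have "card ?A = card ?B" by (rule bij_betw_same_card)
  also have "\<dots> = centralizer_size (cyclic_type ({..<n}, g))"
    by (intro card_conjugators permutes_imp_bij g assms) simp
  finally show ?thesis .
qed

text \<open>
  For a given list \<open>js\<close> of factors, exactly one choice of the summation indices \<open>as\<close> matches their
  rows.
\<close>

lemma row_indices_iff:
  assumes "length as = n" "length js = n"
  shows "map (fst \<circ> u) js = map (\<lambda>i. as ! g i) [0..<n] \<longleftrightarrow>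
    map (\<lambda>i. fst (u (js ! inv g i))) [0..<n] = as"
proof
  assume *: "map (fst \<circ> u) js = map (\<lambda>i. as ! g i) [0..<n]"
  have "fst (u (js ! inv g i)) = as ! i" if "i < n" for i
  proof -
    have "inv g i < n" using permutes_in_image[OF permutes_inv[OF g], of i] that by simp
    then show ?thesis
      using arg_cong[OF *, of "\<lambda>xs. xs ! inv g i"] assms permutes_inverses(1)[OF g] by simp
  qed
  then show "map (\<lambda>i. fst (u (js ! inv g i))) [0..<n] = as"
    using assms by (intro nth_equalityI) auto
next
  assume *: "map (\<lambda>i. fst (u (js ! inv g i))) [0..<n] = as"
  show "map (fst \<circ> u) js = map (\<lambda>i. as ! g i) [0..<n]"
    using assms permutes_in_image[OF g] permutes_inverses(2)[OF g]
    by (intro nth_equalityI) (auto simp flip: *)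
qed

lemma trace_summand_nonzero:
  assumes "finite I" "(normal_D as (map (\<lambda>i. as ! g i) [0..<n]) (X_prod I u) when length as = n) \<noteq> 0"
  shows "as \<in> (\<lambda>js. map (\<lambda>i. fst (u (js ! inv g i))) [0..<n]) ` injective_lists I n"
proof -
  have len: "length as = n" and nz: "normal_D as (map (\<lambda>i. as ! g i) [0..<n]) (X_prod I u) \<noteq> 0"
    using assms(2) by auto
  have "{js \<in> injective_lists I (length as). map (fst \<circ> u) js = map (\<lambda>i. as ! g i) [0..<n]} \<noteq> {}"
  proof
    assume empty: "{js \<in> injective_lists I (length as). map (fst \<circ> u) js = map (\<lambda>i. as ! g i) [0..<n]} = {}"
    have "length as = length (map (\<lambda>i. as ! g i) [0..<n])" using len by simp
    from nz[unfolded normal_D_X_prod[OF assms(1) this] empty] show False by simp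
  qed
  then obtain js where js: "js \<in> injective_lists I (length as)"
    "map (fst \<circ> u) js = map (\<lambda>i. as ! g i) [0..<n]" by blast
  have J: "js \<in> injective_lists I n" using js(1) len by simp
  then have "length js = n" by (simp add: injective_lists_def)
  from row_indices_iff[OF len this, of u] js(2) have "map (\<lambda>i. fst (u (js ! inv g i))) [0..<n] = as" by blast
  with J show ?thesis by (intro image_eqI[where x = js]) simp_all
qed

lemma pol_linear_trace_summand:
  "pol_linear (\<lambda>f. normal_D as (map (\<lambda>i. as ! g i) [0..<n]) f when length as = n)"
  using pol_linear_normal_D[of as "map (\<lambda>i. as ! g i) [0..<n]"]
  by (cases "length as = n") (simp_all add: linear_map_on_def)

lemma finite_trace_support_X_prod:
  assumes "finite I"
  shows "finite {as. (normal_D as (map (\<lambda>i. as ! g i) [0..<n]) (X_prod I u) when length as = n) \<noteq> 0}"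
proof (rule finite_subset)
  show "finite ((\<lambda>js. map (\<lambda>i. fst (u (js ! inv g i))) [0..<n]) ` injective_lists I n)"
    by (intro finite_imageI finite_injective_lists assms)
qed (rule subsetI, rule trace_summand_nonzero[OF assms], erule CollectD)

lemma finite_trace_support:
  "finite {as. (normal_D as (map (\<lambda>i. as ! g i) [0..<n]) f when length as = n) \<noteq> 0}"
  by (rule finite_support_of_pol_linear_family[OF pol_linear_trace_summand finite_trace_support_X_prod])

lemma pol_linear_trace_operator: "pol_linear (trace_operator g n)"
  unfolding trace_operator_def[abs_def]
  by (rule pol_linear_Sum_any[OF pol_linear_trace_summand finite_trace_support_X_prod])

text \<open>
  Replacing the rows of the factors \<open>js\<close> by \<open>as\<close> permutes the row indices by the induced permutation; the
  factors outside \<open>js\<close> are fixed.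
\<close>

lemma X_prod_permute_rows:
  assumes "finite I" "js \<in> injective_lists I n"
  shows "prod_list (map X (zip (map (\<lambda>i. fst (u (js ! inv g i))) [0..<n]) (map (snd \<circ> u) js))) *
      X_prod (I - set js) u = X_prod I (permute_rows (induced_permutation g js) u)"
proof -
  have js: "distinct js" "length js = n" "set js \<subseteq> I" using assms(2) by (auto simp: injective_lists_def)
  let ?v = "permute_rows (induced_permutation g js) u"
  have perm: "inv (induced_permutation g js) permutes set js"
    by (rule permutes_inv[OF induced_permutation_permutes[OF js(1,2)]])
  have "map X (zip (map (\<lambda>i. fst (u (js ! inv g i))) [0..<n]) (map (snd \<circ> u) js)) = map (X \<circ> ?v) js"
  proof (rule nth_equalityI)
    fix i assume "i < length (map X (zip (map (\<lambda>i. fst (u (js ! inv g i))) [0..<n]) (map (snd \<circ> u) js)))"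
    then have "i < n" using js(2) by simp
    then show "map X (zip (map (\<lambda>i. fst (u (js ! inv g i))) [0..<n]) (map (snd \<circ> u) js)) ! i =
        map (X \<circ> ?v) js ! i"
      using inv_induced_permutation_nth[OF js(1,2)] js(2) by (simp add: permute_rows_def)
  qed (simp add: js(2))
  then have "prod_list (map X (zip (map (\<lambda>i. fst (u (js ! inv g i))) [0..<n]) (map (snd \<circ> u) js))) =
      X_prod (set js) ?v"
    using js(1) by (simp add: prod.distinct_set_conv_list X_prod_def comp_def)
  moreover have "X_prod (I - set js) u = X_prod (I - set js) ?v"
    unfolding X_prod_def by (rule prod.cong) (auto simp: permute_rows_def permutes_not_in[OF perm])
  ultimately show ?thesis
    using prod.subset_diff[OF js(3) assms(1), of "\<lambda>i. X (?v i)"]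
    by (simp only: X_prod_def mult.commute)
qed

lemma trace_operator_X_prod:
  assumes "finite I"
  shows "trace_operator g n (X_prod I u) =
    (\<Sum>js\<in>injective_lists I n. X_prod I (permute_rows (induced_permutation g js) u))"
proof -
  let ?J = "injective_lists I n"
  let ?a = "\<lambda>js. map (\<lambda>i. fst (u (js ! inv g i))) [0..<n]"
  let ?h = "\<lambda>js. X_prod I (permute_rows (induced_permutation g js) u)"
  have J: "finite ?J" by (rule finite_injective_lists[OF assms])
  have "trace_operator g n (X_prod I u) =
      (\<Sum>as\<in>?a ` ?J. normal_D as (map (\<lambda>i. as ! g i) [0..<n]) (X_prod I u) when length as = n)"
    unfolding trace_operator_def
  proof (rule Sum_any.expand_superset)
    show "finite (?a ` ?J)" using J by simp
  qed (rule subsetI, rule trace_summand_nonzero[OF assms], erule CollectD)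
  also have "\<dots> = (\<Sum>as\<in>?a ` ?J. \<Sum>js\<in>{js \<in> ?J. ?a js = as}. ?h js)"
  proof (rule sum.cong[OF refl])
    fix as assume "as \<in> ?a ` ?J"
    then have len: "length as = n" by auto
    have "{js \<in> injective_lists I (length as). map (fst \<circ> u) js = map (\<lambda>i. as ! g i) [0..<n]} =
        {js \<in> ?J. ?a js = as}"
      using row_indices_iff[OF len] len by (auto simp: injective_lists_def)
    then have "normal_D as (map (\<lambda>i. as ! g i) [0..<n]) (X_prod I u) =
        (\<Sum>js\<in>{js \<in> ?J. ?a js = as}. prod_list (map X (zip as (map (snd \<circ> u) js))) * X_prod (I - set js) u)"
      using normal_D_X_prod[OF assms, of as "map (\<lambda>i. as ! g i) [0..<n]"] len by simp
    also have "\<dots> = (\<Sum>js\<in>{js \<in> ?J. ?a js = as}. ?h js)"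
      by (rule sum.cong[OF refl]) (use X_prod_permute_rows[OF assms] in auto)
    finally show "(normal_D as (map (\<lambda>i. as ! g i) [0..<n]) (X_prod I u) when length as = n) =
        (\<Sum>js\<in>{js \<in> ?J. ?a js = as}. ?h js)"
      using len by simp
  qed
  also have "\<dots> = (\<Sum>js\<in>?J. ?h js)"
    by (rule sum.group) (use J in auto)
  finally show ?thesis .
qed

text \<open>
  The lists of chosen factors are grouped by the finite permutation that they induce.  All groups have
  the same size, the order of the centralizer.
\<close>

lemma trace_operator_X_prod_eq_sum_permutations:
  assumes "finite I" "n > 0"
  shows "trace_operator g n (X_prod I u) = of_nat (centralizer_size (cyclic_type ({..<n}, g))) *
    (\<Sum>p\<in>{p \<in> permutations_within I. cyclic_type p = cyclic_type ({..<n}, g)}. X_prod I (permute_rows (snd p) u))"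
proof -
  let ?J = "injective_lists I n" and ?\<Delta> = "cyclic_type ({..<n}, g)"
  let ?T = "{p \<in> permutations_within I. cyclic_type p = ?\<Delta>}"
  let ?f = "\<lambda>js. (set js, induced_permutation g js)"
  let ?h = "\<lambda>p. X_prod I (permute_rows (snd p) u)"
  have img: "?f ` ?J \<subseteq> ?T"
    using cyclic_type_induced_permutation induced_permutation_permutes assms(2)
    by (auto simp: injective_lists_def permutations_within_def finite_permutations_def)
  have "trace_operator g n (X_prod I u) = (\<Sum>js\<in>?J. ?h (?f js))"
    using trace_operator_X_prod[OF assms(1)] by simp
  also have "\<dots> = (\<Sum>p\<in>?T. \<Sum>js\<in>{js \<in> ?J. ?f js = p}. ?h (?f js))"
    by (rule sum.group[symmetric])
      (use assms img finite_injective_lists finite_permutations_within in auto)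
  also have "\<dots> = (\<Sum>p\<in>?T. of_nat (centralizer_size ?\<Delta>) * ?h p)"
  proof (rule sum.cong[OF refl])
    fix p assume p: "p \<in> ?T"
    obtain d w where dw: "p = (d, w)" by (cases p)
    have "(\<Sum>js\<in>{js \<in> ?J. ?f js = p}. ?h (?f js)) = (\<Sum>js\<in>{js \<in> ?J. ?f js = p}. ?h p)"
      by (rule sum.cong) auto
    also have "\<dots> = of_nat (card {js \<in> ?J. ?f js = p}) * ?h p" by simp
    also have "card {js \<in> ?J. ?f js = p} = centralizer_size ?\<Delta>"
      unfolding dw using p dw
      by (intro card_lists_inducing) (auto simp: permutations_within_def finite_permutations_def)
    finally show "(\<Sum>js\<in>{js \<in> ?J. ?f js = p}. ?h (?f js)) = of_nat (centralizer_size ?\<Delta>) * ?h p" .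
  qed
  finally show ?thesis by (simp add: sum_distrib_left)
qed

end


section \<open>Operators represented by formal sums\<close>

lemma pol_const_simps:
  "pol_const 0 = 0" "pol_const 1 = 1" "pol_const (a + b) = pol_const a + pol_const b"
  "pol_const a * pol_const b = pol_const (a * b)" "pol_const (of_nat n) = of_nat n"
  by (simp_all add: pol_const_def single_add mult_single)

lemma pol_const_sum: "pol_const (sum f A) = (\<Sum>i\<in>A. pol_const (f i))"
  by (induction A rule: infinite_finite_induct) (simp_all add: pol_const_simps)

text \<open>
  Only the finitely many finite permutations within \<open>I\<close> act on products labelled by \<open>I\<close>, so the sum
  makes sense for every formal sum \<open>F\<close>.
\<close>

definition represents :: "formal_sum \<Rightarrow> operator \<Rightarrow> bool" where
  "represents F T \<longleftrightarrow> pol_linear T \<and>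
    (\<forall>I u. finite I \<longrightarrow>
      T (X_prod I u) = (\<Sum>p\<in>permutations_within I. pol_const (F p) * X_prod I (permute_rows (snd p) u)))"

lemma represents_add:
  assumes "represents F S" "represents G T"
  shows "represents (F + G) (S + T)"
  using assms pol_linear_plus[of S T] unfolding represents_def
  by (simp add: pol_const_simps distrib_right sum.distrib)

lemma represents_scale:
  assumes "represents F T"
  shows "represents (fs_scale c F) (op_scale c T)"
  using assms pol_linear_op_scale[of T c] unfolding represents_def
  by (simp add: op_scale_def fs_scale_def sum_distrib_left pol_const_simps flip: mult.assoc)

lemma represents_zero: "represents 0 0"
  by (simp add: represents_def linear_map_on_def pol_const_simps)

lemma represents_unique_operator: "represents F S \<Longrightarrow> represents F T \<Longrightarrow> S = T"
  unfolding represents_def by (rule pol_linear_eqI) auto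

lemma permute_rows_comp:
  assumes "bij v" "bij w"
  shows "permute_rows v (permute_rows w u) = permute_rows (v \<circ> w) u"
  by (simp add: permute_rows_def o_inv_distrib[OF assms])

lemma permutations_within_bij: "p \<in> permutations_within I \<Longrightarrow> bij (snd p)"
  by (auto simp: permutations_within_def finite_permutations_def intro: permutes_bij)

lemma fperm_mult_in_finite_permutations:
  assumes "p \<in> finite_permutations" "q \<in> finite_permutations"
  shows "fperm_mult p q \<in> finite_permutations"
  using assms
  by (auto simp: finite_permutations_def fperm_mult_def
      intro!: permutes_compose intro: permutes_subset)

text \<open>
  Row permutations form a left action, and a product of two finite permutations lies within \<open>I\<close> exactly
  when both factors do.  Collecting the pairs \<open>(q, r)\<close> by their product gives the coefficients of
  \<open>fs_mult F G\<close>.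
\<close>

lemma represents_comp:
  assumes S: "represents F S" and T: "represents G T"
  shows "represents (fs_mult F G) (S \<circ> T)"
  unfolding represents_def
proof (intro conjI allI impI)
  show "pol_linear (S \<circ> T)"
    using S T by (simp add: represents_def pol_linear_comp)
next
  fix I :: "nat set" and u :: "nat \<Rightarrow> nat \<times> nat"
  assume I: "finite I"
  let ?P = "permutations_within I"
  let ?Y = "\<lambda>p. X_prod I (permute_rows (snd p) u)"
  have P: "finite ?P" by (rule finite_permutations_within[OF I])
  have lin: "pol_linear S" using S by (simp add: represents_def)
  have mult: "fperm_mult q r \<in> ?P" if "q \<in> ?P" "r \<in> ?P" for q r
    using that fperm_mult_in_finite_permutations[of q r]
    by (auto simp: permutations_within_def fperm_mult_def split: prod.splits)
  have comp: "permute_rows (snd q) (permute_rows (snd r) u) = permute_rows (snd (fperm_mult q r)) u"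
    if "q \<in> ?P" "r \<in> ?P" for q r
    using permute_rows_comp[OF permutations_within_bij[OF that(1)] permutations_within_bij[OF that(2)]]
    by (simp add: fperm_mult_def split: prod.splits)
  have "(S \<circ> T) (X_prod I u) = (\<Sum>r\<in>?P. pol_const (G r) * S (?Y r))"
    using T I by (simp add: represents_def pol_linear_sum[OF lin] pol_linear_scale[OF lin])
  also have "\<dots> = (\<Sum>r\<in>?P. \<Sum>q\<in>?P. pol_const (F q * G r) * ?Y (fperm_mult q r))"
  proof (rule sum.cong[OF refl])
    fix r assume r: "r \<in> ?P"
    have "S (?Y r) = (\<Sum>q\<in>?P. pol_const (F q) * X_prod I (permute_rows (snd q) (permute_rows (snd r) u)))"
      using S I by (simp add: represents_def)
    also have "\<dots> = (\<Sum>q\<in>?P. pol_const (F q) * ?Y (fperm_mult q r))"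
      by (rule sum.cong[OF refl]) (simp add: comp r)
    finally show "pol_const (G r) * S (?Y r) = (\<Sum>q\<in>?P. pol_const (F q * G r) * ?Y (fperm_mult q r))"
      by (simp add: sum_distrib_left mult.commute[of "F _"] flip: mult.assoc pol_const_simps(4))
  qed
  also have "\<dots> = (\<Sum>(q, r)\<in>?P \<times> ?P. pol_const (F q * G r) * ?Y (fperm_mult q r))"
    by (subst sum.swap) (simp add: sum.cartesian_product)
  also have "\<dots> = (\<Sum>p\<in>?P. \<Sum>(q, r)\<in>{x \<in> ?P \<times> ?P. (case x of (q, r) \<Rightarrow> fperm_mult q r) = p}.
      pol_const (F q * G r) * ?Y (fperm_mult q r))"
    by (rule sum.group[symmetric]) (use P mult in auto)
  also have "\<dots> = (\<Sum>p\<in>?P. pol_const (fs_mult F G p) * ?Y p)"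
  proof (rule sum.cong[OF refl])
    fix p assume p: "p \<in> ?P"
    have eq: "{x \<in> ?P \<times> ?P. (case x of (q, r) \<Rightarrow> fperm_mult q r) = p} =
        {(q, r). q \<in> finite_permutations \<and> r \<in> finite_permutations \<and> fperm_mult q r = p}"
      using p by (auto simp: permutations_within_def fperm_mult_def)
    have "(\<Sum>(q, r)\<in>{x \<in> ?P \<times> ?P. (case x of (q, r) \<Rightarrow> fperm_mult q r) = p}.
        pol_const (F q * G r) * ?Y (fperm_mult q r)) =
      (\<Sum>(q, r)\<in>{x \<in> ?P \<times> ?P. (case x of (q, r) \<Rightarrow> fperm_mult q r) = p}. pol_const (F q * G r) * ?Y p)"
      by (rule sum.cong) auto
    also have "\<dots> = pol_const (fs_mult F G p) * ?Y p"
      unfolding eq fs_mult_def pol_const_sum sum_distrib_right by (rule sum.cong) auto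
    finally show "(\<Sum>(q, r)\<in>{x \<in> ?P \<times> ?P. (case x of (q, r) \<Rightarrow> fperm_mult q r) = p}.
        pol_const (F q * G r) * ?Y (fperm_mult q r)) = pol_const (fs_mult F G p) * ?Y p" .
  qed
  finally show "(S \<circ> T) (X_prod I u) = (\<Sum>p\<in>?P. pol_const (fs_mult F G p) * ?Y p)" .
qed

text \<open>
  Permuting the rows of the diagonal product \<open>\<Prod>i\<in>d. X (i, i)\<close> produces the permutation matrix of \<open>v\<close> as exponents, from
  which \<open>v\<close> can be read off.
\<close>

lemma lookup_diagonal_monomial:
  assumes "finite d" "v permutes d" "w permutes d"
  shows "Poly_Mapping.lookup (X_prod d (permute_rows v (\<lambda>i. (i, i))))
      (\<Sum>i\<in>d. Poly_Mapping.single (inv w i, i) 1) = (if v = w then 1 else 0)"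
proof -
  let ?m = "\<lambda>v. \<Sum>i\<in>d. Poly_Mapping.single (inv v i, i) (1::nat)"
  have lk: "Poly_Mapping.lookup (?m v) (a, i) = (if i \<in> d \<and> inv v i = a then 1 else 0)" for v a i
  proof -
    have "Poly_Mapping.lookup (?m v) (a, i) = (\<Sum>k\<in>d. if k = i then if inv v i = a then 1 else 0 else 0)"
      unfolding lookup_sum by (rule sum.cong) (auto simp: lookup_single when_def)
    then show ?thesis using assms(1) by (simp add: sum.delta)
  qed
  have inj: "v = w" if eq: "?m v = ?m w"
  proof -
    have "inv v i = inv w i" for i
    proof (cases "i \<in> d")
      case True
      have "(if i \<in> d \<and> inv v i = inv v i then 1 else 0 :: nat) =
          (if i \<in> d \<and> inv w i = inv v i then 1 else 0)"
        unfolding lk[symmetric] by (simp only: eq)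
      then show ?thesis using True by (simp split: if_splits)
    next
      case False
      then show ?thesis
        using permutes_inv[OF assms(2)] permutes_inv[OF assms(3)] by (simp add: permutes_not_in)
    qed
    then have "inv v = inv w" by (rule ext)
    then show ?thesis
      using inv_inv_eq[OF permutes_bij[OF assms(2)]] inv_inv_eq[OF permutes_bij[OF assms(3)]] by metis
  qed
  have "?m v \<noteq> ?m w" if "v \<noteq> w"
  proof
    assume "?m v = ?m w"
    from inj[OF this] that show False by contradiction
  qed
  moreover have "X_prod d (permute_rows v (\<lambda>i. (i, i))) = Poly_Mapping.single (?m v) 1"
    by (simp only: X_prod_eq_single[OF assms(1)] permute_rows_def fst_conv snd_conv)
  ultimately show ?thesis by (cases "v = w") (simp_all only: lookup_single when_def if_True if_False refl simp_thms)
qed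

text \<open>
  On the diagonal product over \<open>d\<close>, the coefficient of the monomial of \<open>w\<close> is the sum of all \<open>F (e, w)\<close> with
  \<open>e \<subseteq> d\<close> containing the support of \<open>w\<close>.  By induction on the size of \<open>d\<close> only the term with \<open>e = d\<close>
  is still unknown.
\<close>

lemma represents_unique_formal_sum:
  assumes F: "represents F T" and G: "represents G T"
    and "\<And>p. p \<notin> finite_permutations \<Longrightarrow> F p = 0" "\<And>p. p \<notin> finite_permutations \<Longrightarrow> G p = 0"
  shows "F = G"
proof -
  have "F (d, w) = G (d, w)" if "(d, w) \<in> finite_permutations" for d w
    using that
  proof (induction "card d" arbitrary: d rule: less_induct)
    case less
    then have d: "finite d" "d \<noteq> {}" "w permutes d" by (auto simp: finite_permutations_def)
    \<comment> \<open>The finite permutations within \<open>d\<close> that act as \<open>w\<close> and hence produce the same monomial.\<close>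
    let ?Q = "{p \<in> permutations_within d. snd p = w}"
    have fin: "finite (permutations_within d)" by (rule finite_permutations_within[OF d(1)])
    have coeff: "Poly_Mapping.lookup (T (X_prod d (\<lambda>i. (i, i))))
        (\<Sum>i\<in>d. Poly_Mapping.single (inv w i, i) 1) = sum H ?Q" if "represents H T" for H
    proof -
      have "Poly_Mapping.lookup (T (X_prod d (\<lambda>i. (i, i)))) (\<Sum>i\<in>d. Poly_Mapping.single (inv w i, i) 1) =
          (\<Sum>p\<in>permutations_within d. H p * Poly_Mapping.lookup
            (X_prod d (permute_rows (snd p) (\<lambda>i. (i, i)))) (\<Sum>i\<in>d. Poly_Mapping.single (inv w i, i) 1))"
        using that d(1) by (simp add: represents_def lookup_sum lookup_pol_const_mult)
      also have "\<dots> = (\<Sum>p\<in>permutations_within d. if snd p = w then H p else 0)"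
      proof (rule sum.cong[OF refl])
        fix p assume "p \<in> permutations_within d"
        then have "snd p permutes d"
          by (auto simp: permutations_within_def finite_permutations_def intro: permutes_subset)
        then show "H p * Poly_Mapping.lookup (X_prod d (permute_rows (snd p) (\<lambda>i. (i, i))))
            (\<Sum>i\<in>d. Poly_Mapping.single (inv w i, i) 1) = (if snd p = w then H p else 0)"
          using lookup_diagonal_monomial[OF d(1) _ d(3)] by simp
      qed
      also have "\<dots> = sum H ?Q" using fin by (rule sum.inter_filter[symmetric])
      finally show ?thesis .
    qed
    have dQ: "(d, w) \<in> ?Q" using less.prems by (simp add: permutations_within_def)
    have rest: "sum F (?Q - {(d, w)}) = sum G (?Q - {(d, w)})"
    proof (rule sum.cong[OF refl])
      fix p assume p: "p \<in> ?Q - {(d, w)}"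
      then obtain e where e: "p = (e, w)" "e \<subset> d" "(e, w) \<in> finite_permutations"
        by (cases p) (auto simp: permutations_within_def)
      then show "F p = G p" using less.hyps psubset_card_mono[OF d(1)] by simp
    qed
    have "sum F ?Q = sum G ?Q" using coeff[OF F] coeff[OF G] by simp
    then show ?case
      using fin dQ rest by (simp add: sum.remove[of ?Q "(d, w)"])
  qed
  then show ?thesis
    using assms(3,4) by (auto simp: fun_eq_iff) metis
qed

lemma kappa_eq: "kappa \<Delta> = inverse (of_nat (centralizer_size \<Delta>))"
  by (simp add: kappa_def centralizer_size_def)

lemma degree_pos:
  assumes "young_diagram \<Delta>"
  shows "degree \<Delta> > 0"
proof (rule gr0I)
  assume "degree \<Delta> = 0"
  moreover obtain k where "k \<in># \<Delta>" using assms by (auto simp: young_diagram_def)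
  ultimately show False using assms by (auto simp: young_diagram_def)
qed

lemma W_eq_trace_operator:
  assumes "young_diagram \<Delta>"
  obtains g where "g permutes {..<degree \<Delta>}" "cyclic_type ({..<degree \<Delta>}, g) = \<Delta>"
    "W \<Delta> = op_scale (kappa \<Delta>) (trace_operator g (degree \<Delta>))"
proof -
  let ?P = "\<lambda>g. g permutes {..<degree \<Delta>} \<and> cyclic_type ({..<degree \<Delta>}, g) = \<Delta>"
  have "\<exists>g. ?P g"
    using assms by (intro ex_permutation_of_cyclic_type) (auto simp: young_diagram_def)
  then have "?P (SOME g. ?P g)" by (rule someI_ex)
  moreover have "W \<Delta> = op_scale (kappa \<Delta>) (trace_operator (SOME g. ?P g) (degree \<Delta>))"
    using calculation by (simp add: W_def Let_def trace_operator_def[abs_def])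
  ultimately show thesis using that by blast
qed

text \<open>
  The factor \<open>\<kappa>(\<Delta>)\<close> cancels the number of lists of factors that induce a given permutation.
\<close>

lemma represents_W:
  assumes "young_diagram \<Delta>"
  shows "represents (G_inf \<Delta>) (W \<Delta>)"
proof -
  obtain g where g: "g permutes {..<degree \<Delta>}" "cyclic_type ({..<degree \<Delta>}, g) = \<Delta>"
    and W: "W \<Delta> = op_scale (kappa \<Delta>) (trace_operator g (degree \<Delta>))"
    by (rule W_eq_trace_operator[OF assms])
  have z: "centralizer_size \<Delta> \<noteq> 0"
    using centralizer_size_pos[of \<Delta>] assms by (simp add: young_diagram_def)
  show ?thesis
    unfolding represents_def
  proof (intro conjI allI impI)
    show "pol_linear (W \<Delta>)"
      unfolding W by (intro pol_linear_op_scale pol_linear_trace_operator g)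
  next
    fix I :: "nat set" and u :: "nat \<Rightarrow> nat \<times> nat"
    assume I: "finite I"
    let ?Y = "\<lambda>p. X_prod I (permute_rows (snd p) u)"
    have "W \<Delta> (X_prod I u) = pol_const (kappa \<Delta>) * (of_nat (centralizer_size \<Delta>) *
        (\<Sum>p\<in>{p \<in> permutations_within I. cyclic_type p = \<Delta>}. ?Y p))"
      using trace_operator_X_prod_eq_sum_permutations[OF g(1) I degree_pos[OF assms], of u]
      by (simp add: W op_scale_def g(2))
    also have "\<dots> = (\<Sum>p\<in>{p \<in> permutations_within I. cyclic_type p = \<Delta>}. ?Y p)"
      using z by (simp add: kappa_eq pol_const_simps flip: mult.assoc pol_const_simps(5))
    also have "\<dots> = (\<Sum>p\<in>permutations_within I. if cyclic_type p = \<Delta> then ?Y p else 0)"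
      by (rule sum.inter_filter[OF finite_permutations_within[OF I]])
    also have "\<dots> = (\<Sum>p\<in>permutations_within I. pol_const (G_inf \<Delta> p) * ?Y p)"
      by (rule sum.cong) (auto simp: G_inf_def permutations_within_def pol_const_simps)
    finally show "W \<Delta> (X_prod I u) = (\<Sum>p\<in>permutations_within I. pol_const (G_inf \<Delta> p) * ?Y p)" .
  qed
qed

text \<open>
  For fixed \<open>bs\<close> the only contributing \<open>as\<close> is \<open>bs\<close> rearranged by the inverse of \<open>g\<close>.
\<close>

lemma W_in_U:
  assumes "young_diagram \<Delta>"
  shows "W \<Delta> \<in> U (degree \<Delta>)"
proof -
  define n where "n = degree \<Delta>"
  obtain g where g: "g permutes {..<n}"
    and W: "W \<Delta> = op_scale (kappa \<Delta>) (trace_operator g n)"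
    unfolding n_def by (rule W_eq_trace_operator[OF assms])
  let ?h = "\<lambda>as. map (\<lambda>i. as ! g i) [0..<n]"
  \<comment> \<open>The double sum over \<open>as\<close> and \<open>bs\<close> collapses to the graph of \<open>as \<mapsto> bs\<close>.\<close>
  let ?c = "\<lambda>as bs :: nat list. if bs = ?h as then kappa \<Delta> else 0"
  have inj: "as = map (\<lambda>i. ?h as ! inv g i) [0..<n]" if "length as = n" for as :: "nat list"
  proof (rule nth_equalityI)
    fix i assume "i < length as"
    then have "i < n" "inv g i < n"
      using that permutes_in_image[OF permutes_inv[OF g], of i] by simp_all
    then show "as ! i = map (\<lambda>i. ?h as ! inv g i) [0..<n] ! i"
      by (simp add: permutes_inverses(1)[OF g])
  qed (simp add: that)
  have fin: "finite {as. length as = n \<and> ?c as bs \<noteq> 0}" for bs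
  proof (rule finite_subset)
    show "{as. length as = n \<and> ?c as bs \<noteq> 0} \<subseteq> {map (\<lambda>i. bs ! inv g i) [0..<n]}"
      using inj by (auto split: if_splits)
  qed simp
  have "D_series n ?c f = W \<Delta> f" for f
  proof -
    let ?t = "\<lambda>as. normal_D as (?h as) f when length as = n"
    have "D_series n ?c f = (\<Sum>(as, bs). (pol_const (kappa \<Delta>) * ?t as) when bs = ?h as)"
      unfolding D_series_def
      by (rule Sum_any.cong) (auto simp: op_scale_def pol_const_simps when_def)
    also have "\<dots> = (\<Sum>as. pol_const (kappa \<Delta>) * ?t as)"
      by (rule Sum_any_when_dependent_prod_right)
    also have "\<dots> = pol_const (kappa \<Delta>) * (\<Sum>as. ?t as)"
      by (rule Sum_any_right_distrib[symmetric, OF finite_trace_support[OF g]])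
    also have "\<dots> = W \<Delta> f" by (simp add: W op_scale_def trace_operator_def)
    finally show ?thesis .
  qed
  then have "W \<Delta> = D_series n ?c" by auto
  then show ?thesis
    using fin unfolding U_def n_def[symmetric] by blast
qed


section \<open>The algebra of class functions and the isomorphism\<close>

text \<open>
  The complements of \<open>d\<close> and \<open>d'\<close> in their union have the same size.
\<close>

lemma ex_bij_extending:
  fixes j :: "nat \<Rightarrow> nat"
  assumes "finite d" "finite d'" "bij_betw j d d'"
  obtains \<sigma> where "bij \<sigma>" "\<And>x. x \<in> d \<Longrightarrow> \<sigma> x = j x"
proof -
  have "card (d' - d) = card (d - d')"
  proof -
    have "card d = card d'" using assms(3) by (rule bij_betw_same_card)
    moreover have "card d = card (d \<inter> d') + card (d - d')" "card d' = card (d \<inter> d') + card (d' - d)"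
      using card_Int_Diff[OF assms(1), of d'] card_Int_Diff[OF assms(2), of d] by (simp_all add: Int_commute)
    ultimately show ?thesis by simp
  qed
  then obtain h where h: "bij_betw h (d' - d) (d - d')"
    using assms(1,2) finite_same_card_bij[of "d' - d" "d - d'"] by auto
  \<comment> \<open>On \<open>d\<close> as prescribed, any bijection from \<open>d' - d\<close> to \<open>d - d'\<close>, the identity elsewhere.\<close>
  define \<sigma> where "\<sigma> = (\<lambda>x. if x \<in> d then j x else if x \<in> d' then h x else x)"
  have b1: "bij_betw \<sigma> d d'"
    using assms(3) by (rule bij_betw_cong[THEN iffD1, rotated]) (simp add: \<sigma>_def)
  have b2: "bij_betw \<sigma> (d' - d) (d - d')"
    using h by (rule bij_betw_cong[THEN iffD1, rotated]) (simp add: \<sigma>_def)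
  have "bij_betw \<sigma> (d \<union> (d' - d)) (d' \<union> (d - d'))"
    by (rule bij_betw_combine[OF b1 b2]) auto
  moreover have "d \<union> (d' - d) = d \<union> d'" "d' \<union> (d - d') = d \<union> d'" by auto
  ultimately have "\<sigma> permutes (d \<union> d')"
    by (intro bij_imp_permutes) (auto simp: \<sigma>_def)
  then have "bij \<sigma>" by (rule permutes_bij)
  then show thesis by (rule that) (simp add: \<sigma>_def)
qed

definition conjugate :: "(nat \<Rightarrow> nat) \<Rightarrow> fperm \<Rightarrow> fperm" where
  "conjugate \<sigma> p = (\<sigma> ` fst p, \<sigma> \<circ> snd p \<circ> inv \<sigma>)"

lemma conjugate_in_finite_permutations:
  assumes "bij \<sigma>" "p \<in> finite_permutations"
  shows "conjugate \<sigma> p \<in> finite_permutations"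
proof -
  obtain d w where p: "p = (d, w)" "finite d" "d \<noteq> {}" "w permutes d"
    using assms(2) by (auto simp: finite_permutations_def)
  have "bij (\<sigma> \<circ> w \<circ> inv \<sigma>)"
    using assms(1) permutes_bij[OF p(4)] by (intro bij_comp bij_imp_bij_inv)
  moreover have "(\<sigma> \<circ> w \<circ> inv \<sigma>) x = x" if "x \<notin> \<sigma> ` d" for x
  proof -
    have x: "\<sigma> (inv \<sigma> x) = x" using assms(1) by (simp add: bij_is_surj surj_f_inv_f)
    then have "inv \<sigma> x \<notin> d" using that by force
    then show ?thesis using p(4) x by (simp add: permutes_not_in)
  qed
  ultimately have "(\<sigma> \<circ> w \<circ> inv \<sigma>) permutes \<sigma> ` d"
    unfolding permutes_def bij_iff by blast
  then show ?thesis using p by (simp add: conjugate_def finite_permutations_def)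
qed

lemma conjugate_inv:
  assumes "bij \<sigma>"
  shows "conjugate (inv \<sigma>) (conjugate \<sigma> p) = p" "conjugate \<sigma> (conjugate (inv \<sigma>) p) = p"
  using assms
  by (simp_all add: conjugate_def prod_eq_iff fun_eq_iff image_comp inv_inv_eq bij_is_inj bij_is_surj
      surj_f_inv_f image_image)

lemma conjugate_mult:
  assumes "bij \<sigma>"
  shows "fperm_mult (conjugate \<sigma> p) (conjugate \<sigma> q) = conjugate \<sigma> (fperm_mult p q)"
  using assms
  by (simp add: conjugate_def fperm_mult_def image_Un fun_eq_iff bij_is_inj split: prod.splits)

lemma cyclic_type_of_conjugate:
  assumes "bij \<sigma>" "p \<in> finite_permutations"
  shows "cyclic_type (conjugate \<sigma> p) = cyclic_type p"
proof -
  obtain d w where p: "p = (d, w)" "finite d" "w permutes d"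
    using assms(2) by (auto simp: finite_permutations_def)
  show ?thesis
    unfolding p conjugate_def fst_conv snd_conv
  proof (rule cyclic_type_conjugate)
    show "bij_betw w d d" using p(3) by (rule permutes_imp_bij)
    show "bij_betw \<sigma> d (\<sigma> ` d)"
      using assms(1) by (meson bij_betw_subset subset_UNIV)
  qed (use p assms(1) in \<open>simp_all add: bij_is_inj\<close>)
qed

text \<open>
  A conjugating bijection exists because the number of them, the order of a centralizer, is positive.
\<close>

lemma conjugate_of_cyclic_type_eq:
  assumes "p \<in> finite_permutations" "q \<in> finite_permutations" "cyclic_type p = cyclic_type q"
  obtains \<sigma> where "bij \<sigma>" "q = conjugate \<sigma> p"
proof -
  obtain d w where p: "p = (d, w)" "finite d" "w permutes d"
    using assms(1) by (auto simp: finite_permutations_def)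
  obtain d' w' where q: "q = (d', w')" "finite d'" "w' permutes d'"
    using assms(2) by (auto simp: finite_permutations_def)
  note b = permutes_imp_bij[OF p(3)] and b' = permutes_imp_bij[OF q(3)]
  have "card (conjugators d w d' w') > 0"
    using card_conjugators[OF p(2) b q(2) b'] assms(3) p(1) q(1)
      centralizer_size_pos[OF zero_notin_cyclic_type[OF p(2) b]] by simp
  then obtain j where "j \<in> conjugators d w d' w'" by (metis card_gt_0_iff ex_in_conv)
  then have j: "bij_betw j d d'" "\<And>x. x \<in> d \<Longrightarrow> j (w x) = w' (j x)"
    by (auto simp: conjugators_def)
  obtain \<sigma> where \<sigma>: "bij \<sigma>" "\<And>x. x \<in> d \<Longrightarrow> \<sigma> x = j x"
    using ex_bij_extending[OF p(2) q(2) j(1)] by blast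
  have d': "d' = \<sigma> ` d"
    using j(1) \<sigma>(2) by (auto simp: bij_betw_def)
  have "w' (\<sigma> x) = \<sigma> (w x)" for x
  proof (cases "x \<in> d")
    case True
    then show ?thesis using j(2) \<sigma>(2) permutes_in_image[OF p(3)] by simp
  next
    case False
    then have "\<sigma> x \<notin> d'" unfolding d' using \<sigma>(1) by (simp add: inj_image_mem_iff bij_is_inj)
    then show ?thesis using False p(3) q(3) by (simp add: permutes_not_in)
  qed
  then have "w' (\<sigma> (inv \<sigma> x)) = \<sigma> (w (inv \<sigma> x))" for x by blast
  then have "w' = \<sigma> \<circ> w \<circ> inv \<sigma>"
    using \<sigma>(1) by (simp add: fun_eq_iff bij_is_surj surj_f_inv_f)
  then show thesis using that[OF \<sigma>(1)] d' p(1) q(1) by (simp add: conjugate_def)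
qed

text \<open>
  The formal sums that are constant on cyclic types and have bounded support.  This describes \<open>A_inf\<close>
  intrinsically, which is what makes its closure under multiplication accessible.
\<close>

definition class_functions :: "formal_sum set" where
  "class_functions = {F. (\<forall>p. p \<notin> finite_permutations \<longrightarrow> F p = 0) \<and>
     (\<forall>p\<in>finite_permutations. \<forall>q\<in>finite_permutations. cyclic_type p = cyclic_type q \<longrightarrow> F p = F q) \<and>
     (\<exists>K. \<forall>p. F p \<noteq> 0 \<longrightarrow> card (fst p) \<le> K)}"

lemma class_functionsI:
  assumes "\<And>p. p \<notin> finite_permutations \<Longrightarrow> F p = 0"
    "\<And>p q. p \<in> finite_permutations \<Longrightarrow> q \<in> finite_permutations \<Longrightarrow>
      cyclic_type p = cyclic_type q \<Longrightarrow> F p = F q"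
    "\<And>p. F p \<noteq> 0 \<Longrightarrow> card (fst p) \<le> K"
  shows "F \<in> class_functions"
  unfolding class_functions_def using assms by blast

lemma class_functionsE:
  assumes "F \<in> class_functions"
  obtains K where "\<And>p. p \<notin> finite_permutations \<Longrightarrow> F p = 0"
    "\<And>p q. p \<in> finite_permutations \<Longrightarrow> q \<in> finite_permutations \<Longrightarrow>
      cyclic_type p = cyclic_type q \<Longrightarrow> F p = F q"
    "\<And>p. F p \<noteq> 0 \<Longrightarrow> card (fst p) \<le> K"
  using assms unfolding class_functions_def by blast

lemma degree_cyclic_type_finite_permutation:
  "p \<in> finite_permutations \<Longrightarrow> degree (cyclic_type p) = card (fst p)"
  by (auto simp: finite_permutations_def intro!: degree_cyclic_type permutes_imp_bij)

lemma young_diagram_cyclic_type: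
  "p \<in> finite_permutations \<Longrightarrow> young_diagram (cyclic_type p)"
  by (auto simp: finite_permutations_def young_diagram_def cyclic_type_eq_empty_iff
      dest: zero_notin_cyclic_type[OF _ permutes_imp_bij])

lemma ex_finite_permutation_of_cyclic_type:
  assumes "young_diagram \<Delta>"
  shows "\<exists>w. ({..<degree \<Delta>}, w) \<in> finite_permutations \<and> cyclic_type ({..<degree \<Delta>}, w) = \<Delta>"
  using ex_permutation_of_cyclic_type[of "{..<degree \<Delta>}" \<Delta>] assms degree_pos[OF assms]
  by (auto simp: finite_permutations_def young_diagram_def)

text \<open>
  Each of these diagrams is the cyclic type of one of the finitely many finite permutations within \<open>{..<K}\<close>.
\<close>

lemma finite_young_diagrams: "finite {\<Delta>. young_diagram \<Delta> \<and> degree \<Delta> \<le> K}"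
proof (rule finite_subset)
  show "{\<Delta>. young_diagram \<Delta> \<and> degree \<Delta> \<le> K} \<subseteq> cyclic_type ` permutations_within {..<K}"
  proof
    fix \<Delta> assume "\<Delta> \<in> {\<Delta>. young_diagram \<Delta> \<and> degree \<Delta> \<le> K}"
    then have \<Delta>: "young_diagram \<Delta>" "degree \<Delta> \<le> K" by auto
    obtain w where w: "({..<degree \<Delta>}, w) \<in> finite_permutations" "cyclic_type ({..<degree \<Delta>}, w) = \<Delta>"
      using ex_finite_permutation_of_cyclic_type[OF \<Delta>(1)] by blast
    then have "({..<degree \<Delta>}, w) \<in> permutations_within {..<K}"
      using \<Delta>(2) by (auto simp: permutations_within_def)
    with w(2) show "\<Delta> \<in> cyclic_type ` permutations_within {..<K}" by (metis image_eqI)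
  qed
  show "finite (cyclic_type ` permutations_within {..<K})"
    by (simp add: finite_permutations_within)
qed

lemma sum_fun_apply: "(\<Sum>i\<in>A. f i) x = (\<Sum>i\<in>A. f i x)"
  by (induction A rule: infinite_finite_induct) simp_all

text \<open>
  A class function is the combination of the \<open>G_inf \<Delta>\<close> whose coefficients are its values at
  representatives \<open>rep \<Delta>\<close>; the bound on the support leaves finitely many \<open>\<Delta>\<close>.
\<close>

lemma class_functions_subset_A_inf: "class_functions \<subseteq> A_inf"
proof
  fix F assume F: "F \<in> class_functions"
  obtain K where F0: "\<And>p. p \<notin> finite_permutations \<Longrightarrow> F p = 0"
    and Fc: "\<And>p q. p \<in> finite_permutations \<Longrightarrow> q \<in> finite_permutations \<Longrightarrow>
      cyclic_type p = cyclic_type q \<Longrightarrow> F p = F q"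
    and K: "\<And>p. F p \<noteq> 0 \<Longrightarrow> card (fst p) \<le> K"
    using F by (rule class_functionsE) (rule that)
  let ?T = "{\<Delta>. young_diagram \<Delta> \<and> degree \<Delta> \<le> K}"
  have "\<forall>\<Delta>. \<exists>p. young_diagram \<Delta> \<longrightarrow> p \<in> finite_permutations \<and> cyclic_type p = \<Delta>"
    using ex_finite_permutation_of_cyclic_type by blast
  then obtain rep where rep: "\<And>\<Delta>. young_diagram \<Delta> \<Longrightarrow> rep \<Delta> \<in> finite_permutations"
    "\<And>\<Delta>. young_diagram \<Delta> \<Longrightarrow> cyclic_type (rep \<Delta>) = \<Delta>"
    by metis
  \<comment> \<open>At \<open>p\<close> only the summand of the cyclic type of \<open>p\<close> survives.\<close>
  have "F = (\<Sum>\<Delta>\<in>?T. fs_scale (F (rep \<Delta>)) (G_inf \<Delta>))"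
  proof
    fix p
    have "(\<Sum>\<Delta>\<in>?T. fs_scale (F (rep \<Delta>)) (G_inf \<Delta>)) p = (\<Sum>\<Delta>\<in>?T. F (rep \<Delta>) * G_inf \<Delta> p)"
      by (simp add: sum_fun_apply fs_scale_def)
    also have "\<dots> = F p"
    proof (cases "p \<in> finite_permutations")
      case False
      then show ?thesis by (simp add: F0 G_inf_def)
    next
      case True
      have "(\<Sum>\<Delta>\<in>?T. F (rep \<Delta>) * G_inf \<Delta> p) =
          (\<Sum>\<Delta>\<in>?T. if \<Delta> = cyclic_type p then F (rep (cyclic_type p)) else 0)"
        using True by (intro sum.cong) (auto simp: G_inf_def)
      also have "\<dots> = (if cyclic_type p \<in> ?T then F (rep (cyclic_type p)) else 0)"
        using finite_young_diagrams by (simp add: sum.delta)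
      also have "F (rep (cyclic_type p)) = F p"
        using rep young_diagram_cyclic_type[OF True] True by (intro Fc) auto
      also have "(if cyclic_type p \<in> ?T then F p else 0) = F p"
        using K[of p] young_diagram_cyclic_type[OF True] degree_cyclic_type_finite_permutation[OF True]
        by auto
      finally show ?thesis .
    qed
    finally show "F p = (\<Sum>\<Delta>\<in>?T. fs_scale (F (rep \<Delta>)) (G_inf \<Delta>)) p" by simp
  qed
  also have "\<dots> \<in> A_inf"
    unfolding A_inf_def by (intro fs.span_sum fs.span_scale fs.span_base) auto
  finally show "F \<in> A_inf" .
qed

lemma A_inf_subset_class_functions: "A_inf \<subseteq> class_functions"
  unfolding A_inf_def
proof (rule fs.span_minimal)
  show "{G_inf \<Delta> | \<Delta>. young_diagram \<Delta>} \<subseteq> class_functions"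
  proof
    fix F assume "F \<in> {G_inf \<Delta> | \<Delta>. young_diagram \<Delta>}"
    then obtain \<Delta> where "F = G_inf \<Delta>" by blast
    then show "F \<in> class_functions"
      using degree_cyclic_type_finite_permutation
      by (auto simp: class_functions_def G_inf_def intro!: exI[of _ "degree \<Delta>"])
  qed
  show "fs.subspace class_functions"
  proof (rule fs.subspaceI)
    show "0 \<in> class_functions" by (simp add: class_functions_def)
  next
    fix F G assume F: "F \<in> class_functions" and G: "G \<in> class_functions"
    obtain K where K: "\<And>p. p \<notin> finite_permutations \<Longrightarrow> F p = 0"
      "\<And>p q. p \<in> finite_permutations \<Longrightarrow> q \<in> finite_permutations \<Longrightarrow>
        cyclic_type p = cyclic_type q \<Longrightarrow> F p = F q"
      "\<And>p. F p \<noteq> 0 \<Longrightarrow> card (fst p) \<le> K"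
      using F by (rule class_functionsE) (rule that)
    obtain L where L: "\<And>p. p \<notin> finite_permutations \<Longrightarrow> G p = 0"
      "\<And>p q. p \<in> finite_permutations \<Longrightarrow> q \<in> finite_permutations \<Longrightarrow>
        cyclic_type p = cyclic_type q \<Longrightarrow> G p = G q"
      "\<And>p. G p \<noteq> 0 \<Longrightarrow> card (fst p) \<le> L"
      using G by (rule class_functionsE) (rule that)
    show "F + G \<in> class_functions"
    proof (rule class_functionsI[where K = "max K L"])
      show "(F + G) p = 0" if "p \<notin> finite_permutations" for p
        using K(1)[OF that] L(1)[OF that] by simp
      show "(F + G) p = (F + G) q"
        if "p \<in> finite_permutations" "q \<in> finite_permutations" "cyclic_type p = cyclic_type q" for p q
        using K(2)[OF that] L(2)[OF that] by simp
      show "card (fst p) \<le> max K L" if "(F + G) p \<noteq> 0" for p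
      proof (cases "F p = 0")
        case True
        then have "G p \<noteq> 0" using that by simp
        then show ?thesis using L(3)[of p] by simp
      qed (use K(3)[of p] in simp)
    qed
  next
    fix c F assume F: "F \<in> class_functions"
    obtain K where K: "\<And>p. p \<notin> finite_permutations \<Longrightarrow> F p = 0"
      "\<And>p q. p \<in> finite_permutations \<Longrightarrow> q \<in> finite_permutations \<Longrightarrow>
        cyclic_type p = cyclic_type q \<Longrightarrow> F p = F q"
      "\<And>p. F p \<noteq> 0 \<Longrightarrow> card (fst p) \<le> K"
      using F by (rule class_functionsE) (rule that)
    show "fs_scale c F \<in> class_functions"
    proof (rule class_functionsI[where K = K])
      show "fs_scale c F p = fs_scale c F q"
        if "p \<in> finite_permutations" "q \<in> finite_permutations" "cyclic_type p = cyclic_type q" for p q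
        using K(2)[OF that] by (simp add: fs_scale_def)
    qed (use K(1,3) in \<open>simp_all add: fs_scale_def\<close>)
  qed
qed

lemma A_inf_eq_class_functions: "A_inf = class_functions"
  using class_functions_subset_A_inf A_inf_subset_class_functions by blast

text \<open>
  Conjugation by a bijection of the natural numbers permutes the factorizations occurring in the product,
  so the product of class functions is a class function; and \<open>card (d \<union> e) \<le> card d + card e\<close> bounds
  its support.
\<close>

lemma fs_mult_in_A_inf:
  assumes "F \<in> A_inf" "G \<in> A_inf"
  shows "fs_mult F G \<in> A_inf"
proof -
  have F: "F \<in> class_functions" and G: "G \<in> class_functions"
    using assms A_inf_eq_class_functions by auto
  let ?S = "\<lambda>p. {(q, r). q \<in> finite_permutations \<and> r \<in> finite_permutations \<and> fperm_mult q r = p}"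
  have nz: "\<exists>q r. q \<in> finite_permutations \<and> r \<in> finite_permutations \<and> fperm_mult q r = p \<and> F q \<noteq> 0 \<and> G r \<noteq> 0"
    if nonzero: "fs_mult F G p \<noteq> 0" for p
  proof -
    obtain x where x: "x \<in> ?S p" "(case x of (q, r) \<Rightarrow> F q * G r) \<noteq> 0"
      using nonzero[unfolded fs_mult_def] by (rule sum.not_neutral_contains_not_neutral)
    obtain q r where "x = (q, r)" by (cases x)
    with x have "q \<in> finite_permutations \<and> r \<in> finite_permutations \<and> fperm_mult q r = p \<and>
      F q \<noteq> 0 \<and> G r \<noteq> 0" by simp
    then show ?thesis by blast
  qed
  obtain K where K: "\<And>p q. p \<in> finite_permutations \<Longrightarrow> q \<in> finite_permutations \<Longrightarrow>
      cyclic_type p = cyclic_type q \<Longrightarrow> F p = F q"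
    "\<And>p. F p \<noteq> 0 \<Longrightarrow> card (fst p) \<le> K"
    using F by (rule class_functionsE) (rule that)
  obtain L where L: "\<And>p q. p \<in> finite_permutations \<Longrightarrow> q \<in> finite_permutations \<Longrightarrow>
      cyclic_type p = cyclic_type q \<Longrightarrow> G p = G q"
    "\<And>p. G p \<noteq> 0 \<Longrightarrow> card (fst p) \<le> L"
    using G by (rule class_functionsE) (rule that)
  have conj_F: "F (conjugate \<sigma> q) = F q" and conj_G: "G (conjugate \<sigma> q) = G q"
    if "bij \<sigma>" "q \<in> finite_permutations" for \<sigma> q
    using K(1)[OF conjugate_in_finite_permutations[OF that] that(2) cyclic_type_of_conjugate[OF that]]
      L(1)[OF conjugate_in_finite_permutations[OF that] that(2) cyclic_type_of_conjugate[OF that]] .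
  have conj: "fs_mult F G (conjugate \<sigma> p) = fs_mult F G p" if \<sigma>: "bij \<sigma>" for \<sigma> p
  proof -
    let ?c = "conjugate \<sigma>" and ?c' = "conjugate (inv \<sigma>)"
    have \<sigma>': "bij (inv \<sigma>)" using \<sigma> by (rule bij_imp_bij_inv)
    have "(\<Sum>(q, r)\<in>?S p. F q * G r) = (\<Sum>(q, r)\<in>?S (?c p). F q * G r)"
    proof (rule sum.reindex_bij_witness[of _ "map_prod ?c' ?c'" "map_prod ?c ?c"])
      fix x assume "x \<in> ?S p"
      then obtain q r where x: "x = (q, r)" "q \<in> finite_permutations" "r \<in> finite_permutations"
        "fperm_mult q r = p" by (cases x) simp
      show "map_prod ?c' ?c' (map_prod ?c ?c x) = x"
        by (simp add: x(1) conjugate_inv[OF \<sigma>])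
      show "map_prod ?c ?c x \<in> ?S (?c p)"
        using x by (simp add: conjugate_in_finite_permutations[OF \<sigma>] conjugate_mult[OF \<sigma>])
      show "(case map_prod ?c ?c x of (q, r) \<Rightarrow> F q * G r) = (case x of (q, r) \<Rightarrow> F q * G r)"
        using x by (simp add: conj_F[OF \<sigma>] conj_G[OF \<sigma>])
    next
      fix x assume "x \<in> ?S (?c p)"
      then obtain q r where x: "x = (q, r)" "q \<in> finite_permutations" "r \<in> finite_permutations"
        "fperm_mult q r = ?c p" by (cases x) simp
      show "map_prod ?c ?c (map_prod ?c' ?c' x) = x"
        by (simp add: x(1) conjugate_inv[OF \<sigma>])
      show "map_prod ?c' ?c' x \<in> ?S p"
        using x by (simp add: conjugate_in_finite_permutations[OF \<sigma>'] conjugate_mult[OF \<sigma>']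
            conjugate_inv[OF \<sigma>])
    qed
    then show ?thesis by (simp add: fs_mult_def)
  qed
  have "fs_mult F G \<in> class_functions"
  proof (rule class_functionsI[where K = "K + L"])
    show "fs_mult F G p = 0" if "p \<notin> finite_permutations" for p
      using nz[of p] fperm_mult_in_finite_permutations that by blast
  next
    fix p q assume "p \<in> finite_permutations" "q \<in> finite_permutations" "cyclic_type p = cyclic_type q"
    then obtain \<sigma> where "bij \<sigma>" "q = conjugate \<sigma> p" by (rule conjugate_of_cyclic_type_eq)
    then show "fs_mult F G p = fs_mult F G q" using conj by simp
  next
    fix p assume "fs_mult F G p \<noteq> 0"
    then obtain q r where qr: "fperm_mult q r = p" "F q \<noteq> 0" "G r \<noteq> 0" using nz by blast
    have "fst p = fst q \<union> fst r" using qr(1) by (auto simp: fperm_mult_def split: prod.splits)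
    then have "card (fst p) \<le> card (fst q) + card (fst r)" by (simp add: card_Un_le)
    then show "card (fst p) \<le> K + L" using K(2)[OF qr(2)] L(2)[OF qr(3)] by simp
  qed
  then show ?thesis by (simp add: A_inf_eq_class_functions)
qed

lemma W_in_U_inf: "young_diagram \<Delta> \<Longrightarrow> W \<Delta> \<in> U_inf"
  unfolding U_inf_def using W_in_U degree_pos by (intro op.span_base UN_I[of "degree \<Delta>"]) (auto simp: Suc_le_eq)

lemma ex1_represented:
  assumes "F \<in> A_inf"
  shows "\<exists>!T. represents F T"
proof -
  have "\<exists>T. represents F T"
    using assms unfolding A_inf_def
  proof (induction rule: fs.span_induct_alt)
    case base
    show ?case using represents_zero by blast
  next
    case (step c F G)
    then show ?case using represents_add represents_scale represents_W by blast
  qed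
  then show ?thesis using represents_unique_operator by blast
qed

definition represented_operator :: "formal_sum \<Rightarrow> operator" where
  "represented_operator F = (THE T. represents F T)"

lemma represents_represented_operator: "F \<in> A_inf \<Longrightarrow> represents F (represented_operator F)"
  unfolding represented_operator_def by (rule theI'[OF ex1_represented])

lemma A_inf_add: "F \<in> A_inf \<Longrightarrow> G \<in> A_inf \<Longrightarrow> F + G \<in> A_inf"
  and A_inf_scale: "F \<in> A_inf \<Longrightarrow> fs_scale c F \<in> A_inf"
  and A_inf_zero: "0 \<in> A_inf"
  and G_inf_in_A_inf: "young_diagram \<Delta> \<Longrightarrow> G_inf \<Delta> \<in> A_inf"
  unfolding A_inf_def
  by (auto intro: fs.span_add fs.span_scale fs.span_zero fs.span_base)

lemma linear_represented_operator: "linear_map_on fs_scale op_scale A_inf represented_operator"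
  unfolding linear_map_on_def
proof (intro conjI ballI allI)
  fix F G assume "F \<in> A_inf" "G \<in> A_inf"
  then show "represented_operator (F + G) = represented_operator F + represented_operator G"
    by (intro represents_unique_operator[of "F + G"] represents_add represents_represented_operator A_inf_add)
next
  fix c F assume "F \<in> A_inf"
  then show "represented_operator (fs_scale c F) = op_scale c (represented_operator F)"
    by (intro represents_unique_operator[of "fs_scale c F"] represents_scale represents_represented_operator A_inf_scale)
qed

lemma represented_operator_G_inf: "young_diagram \<Delta> \<Longrightarrow> represented_operator (G_inf \<Delta>) = W \<Delta>"
  by (rule represents_unique_operator[OF represents_represented_operator represents_W])
    (auto intro: G_inf_in_A_inf)

context
  fixes \<psi> :: "formal_sum \<Rightarrow> operator"
  assumes linear: "linear_map_on fs_scale op_scale A_inf \<psi>"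
    and psi_G: "\<And>\<Delta>. young_diagram \<Delta> \<Longrightarrow> \<psi> (G_inf \<Delta>) = W \<Delta>"
begin

lemma psi_add: "F \<in> A_inf \<Longrightarrow> G \<in> A_inf \<Longrightarrow> \<psi> (F + G) = \<psi> F + \<psi> G"
  and psi_scale: "F \<in> A_inf \<Longrightarrow> \<psi> (fs_scale c F) = op_scale c (\<psi> F)"
  using linear by (simp_all add: linear_map_on_def)

lemma psi_zero: "\<psi> 0 = 0"
  using psi_scale[OF A_inf_zero, of 0] by simp

text \<open>
  This pins \<open>\<psi>\<close> down, and everything about \<open>\<psi>\<close> follows from the properties of representation.
\<close>

lemma psi_represents:
  assumes "F \<in> A_inf"
  shows "represents F (\<psi> F)"
proof -
  have "F \<in> A_inf \<and> represents F (\<psi> F)"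
    using assms[unfolded A_inf_def]
  proof (induction rule: fs.span_induct_alt)
    case base
    show ?case unfolding psi_zero using represents_zero A_inf_zero by blast
  next
    case (step c F G)
    then obtain \<Delta> where \<Delta>: "young_diagram \<Delta>" "F = G_inf \<Delta>" by blast
    have F: "F \<in> A_inf" "represents F (\<psi> F)"
      using \<Delta> G_inf_in_A_inf represents_W psi_G by simp_all
    have G: "G \<in> A_inf" "represents G (\<psi> G)" using step.IH by blast+
    have "\<psi> (fs_scale c F + G) = op_scale c (\<psi> F) + \<psi> G"
      by (simp only: psi_add[OF A_inf_scale[OF F(1)] G(1)] psi_scale[OF F(1)])
    then show ?case
      using A_inf_add[OF A_inf_scale[OF F(1)] G(1)] represents_add[OF represents_scale[OF F(2)] G(2)]
      by metis
  qed
  then show ?thesis ..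
qed

lemma image_psi: "\<psi> ` A_inf = op.span {W \<Delta> | \<Delta>. young_diagram \<Delta>}"
proof (intro equalityI subsetI)
  fix T assume "T \<in> op.span {W \<Delta> | \<Delta>. young_diagram \<Delta>}"
  then show "T \<in> \<psi> ` A_inf"
  proof (induction rule: op.span_induct_alt)
    case base
    show ?case using A_inf_zero psi_zero by (metis image_eqI)
  next
    case (step c S T)
    then obtain \<Delta> F where "young_diagram \<Delta>" "S = W \<Delta>" "F \<in> A_inf" "T = \<psi> F" by blast
    then have "op_scale c S + T = \<psi> (fs_scale c (G_inf \<Delta>) + F)" "fs_scale c (G_inf \<Delta>) + F \<in> A_inf"
      using psi_add psi_scale psi_G A_inf_scale G_inf_in_A_inf A_inf_add by simp_all
    then show ?case by blast
  qed
next
  fix T assume "T \<in> \<psi> ` A_inf"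
  then obtain F where F: "F \<in> A_inf" "T = \<psi> F" by blast
  have "F \<in> A_inf \<and> \<psi> F \<in> op.span {W \<Delta> | \<Delta>. young_diagram \<Delta>}"
    using F(1)[unfolded A_inf_def]
  proof (induction rule: fs.span_induct_alt)
    case base
    show ?case unfolding psi_zero using A_inf_zero op.span_zero by blast
  next
    case (step c F G)
    then obtain \<Delta> where \<Delta>: "young_diagram \<Delta>" "F = G_inf \<Delta>" by blast
    have F: "F \<in> A_inf" "\<psi> F \<in> op.span {W \<Delta> | \<Delta>. young_diagram \<Delta>}"
      using \<Delta> G_inf_in_A_inf psi_G by (auto intro: op.span_base)
    have G: "G \<in> A_inf" "\<psi> G \<in> op.span {W \<Delta> | \<Delta>. young_diagram \<Delta>}" using step.IH by blast+
    have eq: "\<psi> (fs_scale c F + G) = op_scale c (\<psi> F) + \<psi> G"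
      by (simp only: psi_add[OF A_inf_scale[OF F(1)] G(1)] psi_scale[OF F(1)])
    show ?case
      unfolding eq
      by (rule conjI A_inf_add[OF A_inf_scale[OF F(1)] G(1)] op.span_add[OF op.span_scale[OF F(2)] G(2)])+
  qed
  then show "T \<in> op.span {W \<Delta> | \<Delta>. young_diagram \<Delta>}" using F(2) by simp
qed

lemma psi_mult:
  assumes "F \<in> A_inf" "G \<in> A_inf"
  shows "\<psi> (fs_mult F G) = \<psi> F \<circ> \<psi> G"
  using assms
  by (intro represents_unique_operator[of "fs_mult F G"] represents_comp psi_represents fs_mult_in_A_inf)

lemma inj_on_psi: "inj_on \<psi> A_inf"
proof (rule inj_onI)
  fix F G assume FG: "F \<in> A_inf" "G \<in> A_inf" "\<psi> F = \<psi> G"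
  show "F = G"
  proof (rule represents_unique_formal_sum)
    show "represents F (\<psi> F)" using FG(1) by (rule psi_represents)
    show "represents G (\<psi> F)" unfolding FG(3) using FG(2) by (rule psi_represents)
  qed (use FG A_inf_eq_class_functions in \<open>auto simp: class_functions_def\<close>)
qed

text \<open>
  The image is the span of the \<open>W \<Delta>\<close>, closed under composition because \<open>A_inf\<close> is closed under
  multiplication; so it is the least subalgebra containing them.
\<close>

lemma W_inf_eq_image_psi: "W_inf = \<psi> ` A_inf"
  unfolding W_inf_def
proof (rule hull_unique)
  show "{W \<Delta> | \<Delta>. young_diagram \<Delta>} \<subseteq> \<psi> ` A_inf"
    unfolding image_psi by (auto intro: op.span_base)
  show "subalgebra_of_U_inf (\<psi> ` A_inf)"
    unfolding subalgebra_of_U_inf_def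
  proof (intro conjI ballI)
    show "\<psi> ` A_inf \<subseteq> U_inf"
      unfolding image_psi using W_in_U_inf unfolding U_inf_def
      by (intro op.span_minimal op.subspace_span) auto
    show "op.subspace (\<psi> ` A_inf)" unfolding image_psi by (rule op.subspace_span)
    fix S T assume "S \<in> \<psi> ` A_inf" "T \<in> \<psi> ` A_inf"
    then obtain F G where "F \<in> A_inf" "G \<in> A_inf" "S = \<psi> F" "T = \<psi> G" by blast
    then show "S \<circ> T \<in> \<psi> ` A_inf"
      using psi_mult fs_mult_in_A_inf by (metis image_eqI)
  qed
  fix B assume "{W \<Delta> | \<Delta>. young_diagram \<Delta>} \<subseteq> B" "subalgebra_of_U_inf B"
  then show "\<psi> ` A_inf \<subseteq> B"
    unfolding image_psi subalgebra_of_U_inf_def by (intro op.span_minimal) auto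
qed

lemma algebra_isomorphism_psi:
  "algebra_isomorphism fs_scale fs_mult A_inf op_scale (\<circ>) W_inf \<psi>"
  unfolding algebra_isomorphism_def W_inf_eq_image_psi
  using linear fs_mult_in_A_inf psi_mult inj_on_psi
  by (auto simp: bij_betw_def image_iff) metis

end

theorem theorem4p1:
  shows "(\<exists>\<psi>. linear_map_on fs_scale op_scale A_inf \<psi> \<and>
               (\<forall>\<Delta>. young_diagram \<Delta> \<longrightarrow> \<psi> (G_inf \<Delta>) = W \<Delta>)) \<and>
         (\<forall>\<psi>. linear_map_on fs_scale op_scale A_inf \<psi> \<longrightarrow>
               (\<forall>\<Delta>. young_diagram \<Delta> \<longrightarrow> \<psi> (G_inf \<Delta>) = W \<Delta>) \<longrightarrow>
               algebra_isomorphism fs_scale fs_mult A_inf op_scale (\<circ>) W_inf \<psi>)"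
  using linear_represented_operator represented_operator_G_inf algebra_isomorphism_psi by blast

end
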